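(* The isomorphism problem of posets of width $d$, including its colored version (deciding whether two posets whose elements carry colors admit a color-preserving isomorphism), reduces in polynomial time to the isomorphism problem of $S_d$-graphs: there is a polynomial-time computable map sending each (colored) poset $P$ of width $d$ to an $S_d$-graph $G_P$ such that for any two such posets $P,Q$, the posets $P$ and $Q$ are (color-preservingly) isomorphic if and only if the graphs $G_P$ and $G_Q$ are isomorphic.
   Context: The width of a poset is the maximum size of an antichain. An isomorphism of posets is a bijection $f$ with $a\preceq b \iff f(a)\preceq f(b)$. A subdivision of a graph $H$ is obtained by repeatedly replacing an edge by a path of length two through a new vertex; an $H$-graph is the intersection graph of a collection of connected subgraphs of some subdivision of $H$. $S_d$ is the star $K_{1,d}$ with $d$ rays. *)

theory Defs
  imports "Graph_Theory.Graph_Theory" "HOL-Computational_Algebra.Polynomial"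
begin

section \<open>Polynomial-time computable maps\<close>

text \<open>
  The machine model is the random access machine with a read-only random access input
  of bits, a write-only output of bits, and a memory of cells holding natural numbers with indirect
  addressing, programmed with structured control flow. The only arithmetic operations are
  addition and truncated subtraction. Hence in \<open>t\<close> steps of a fixed program only numbers with
  \<open>O(t + log |w|)\<close> bits arise on the input \<open>w\<close>, and the uniform cost measure used here is
  polynomially related to Turing machine time. An expression is evaluated at no extra
  cost, as a fixed program contains only finitely many expressions; this changes the running time by
  a constant factor only.
\<close>

datatype expr =
    Const nat
  | Cell expr
  | Input expr
  | Input_Length
  | Plus expr expr
  | Minus expr expr

datatype com =
    Skip
  | Assign expr expr
  | Output expr
  | Seq com com
  | IfElse expr com com
  | While expr com

type_synonym state = "(nat \<Rightarrow> nat) \<times> bool list"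

fun expr_val :: "bool list \<Rightarrow> (nat \<Rightarrow> nat) \<Rightarrow> expr \<Rightarrow> nat" where
  "expr_val w m (Const k) = k"
| "expr_val w m (Cell e) = m (expr_val w m e)"
| "expr_val w m (Input e) = (let i = expr_val w m e in of_bool (i < length w \<and> w ! i))"
| "expr_val w m Input_Length = length w"
| "expr_val w m (Plus e1 e2) = expr_val w m e1 + expr_val w m e2"
| "expr_val w m (Minus e1 e2) = expr_val w m e1 - expr_val w m e2"

text \<open>
  \<open>exec w c s t s'\<close>: on input \<open>w\<close>, the program \<open>c\<close> started in \<open>s\<close> halts after \<open>t\<close> steps in \<open>s'\<close>.
  \<open>Assign e1 e2\<close> stores the value of \<open>e2\<close> in the cell whose address is the value of \<open>e1\<close>, and
  \<open>Output e\<close> appends one bit to the output. Nonzero values count as true.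
\<close>

inductive exec :: "bool list \<Rightarrow> com \<Rightarrow> state \<Rightarrow> nat \<Rightarrow> state \<Rightarrow> bool" for w :: "bool list" where
  Skip: "exec w Skip s 1 s"
| Assign: "exec w (Assign e1 e2) (m, out) 1 (m(expr_val w m e1 := expr_val w m e2), out)"
| Output: "exec w (Output e) (m, out) 1 (m, out @ [expr_val w m e \<noteq> 0])"
| Seq: "exec w c1 s1 t1 s2 \<Longrightarrow> exec w c2 s2 t2 s3 \<Longrightarrow> exec w (Seq c1 c2) s1 (t1 + t2) s3"
| IfTrue: "expr_val w (fst s) e \<noteq> 0 \<Longrightarrow> exec w c1 s t s' \<Longrightarrow> exec w (IfElse e c1 c2) s (1 + t) s'"
| IfFalse: "expr_val w (fst s) e = 0 \<Longrightarrow> exec w c2 s t s' \<Longrightarrow> exec w (IfElse e c1 c2) s (1 + t) s'"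
| WhileFalse: "expr_val w (fst s) e = 0 \<Longrightarrow> exec w (While e c) s 1 s"
| WhileTrue: "expr_val w (fst s1) e \<noteq> 0 \<Longrightarrow> exec w c s1 t1 s2 \<Longrightarrow> exec w (While e c) s2 t2 s3
    \<Longrightarrow> exec w (While e c) s1 (1 + t1 + t2) s3"

inductive_cases exec_SkipE: "exec w Skip s t s'"
inductive_cases exec_AssignE: "exec w (Assign e1 e2) (m, out) t s'"
inductive_cases exec_OutputE: "exec w (Output e) (m, out) t s'"
inductive_cases exec_SeqE: "exec w (Seq c1 c2) s t s'"
inductive_cases exec_IfE: "exec w (IfElse e c1 c2) s t s'"
inductive_cases exec_WhileE: "exec w (While e c) s t s'"

lemma exec_deterministic:
  assumes "exec w c s t s'" and "exec w c s u s''"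
  shows "u = t \<and> s'' = s'"
  using assms
proof (induction arbitrary: u s'' rule: exec.induct)
  case (Skip s)
  from Skip.prems show ?case by (rule exec_SkipE) simp
next
  case (Assign e1 e2 m out)
  from Assign.prems show ?case by (rule exec_AssignE) simp
next
  case (Output e m out)
  from Output.prems show ?case by (rule exec_OutputE) simp
next
  case (Seq c1 s1 t1 s2 c2 t2 s3)
  from Seq.prems obtain t1' s2' t2'
    where *: "exec w c1 s1 t1' s2'" "exec w c2 s2' t2' s''" "u = t1' + t2'"
    by (rule exec_SeqE)
  from Seq.IH(1)[OF *(1)] have **: "t1' = t1" "s2' = s2" by simp_all
  from Seq.IH(2)[OF *(2)[unfolded **]] *(3) ** show ?case by simp
next
  case (IfTrue s e c1 t s' c2)
  from IfTrue.prems obtain t' where *: "exec w c1 s t' s''" "u = 1 + t'"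
    by (rule exec_IfE) (use IfTrue.hyps(1) in auto)
  from IfTrue.IH[OF *(1)] *(2) show ?case by simp
next
  case (IfFalse s e c2 t s' c1)
  from IfFalse.prems obtain t' where *: "exec w c2 s t' s''" "u = 1 + t'"
    by (rule exec_IfE) (use IfFalse.hyps(1) in auto)
  from IfFalse.IH[OF *(1)] *(2) show ?case by simp
next
  case (WhileFalse s e c)
  from WhileFalse.prems show ?case by (rule exec_WhileE) (use WhileFalse.hyps in auto)
next
  case (WhileTrue s1 e c t1 s2 t2 s3)
  from WhileTrue.prems obtain t1' s2' t2'
    where *: "exec w c s1 t1' s2'" "exec w (While e c) s2' t2' s''" "u = 1 + t1' + t2'"
    by (rule exec_WhileE) (use WhileTrue.hyps(1) in auto)
  from WhileTrue.IH(1)[OF *(1)] have **: "t1' = t1" "s2' = s2" by simp_all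
  from WhileTrue.IH(2)[OF *(2)[unfolded **]] *(3) ** show ?case by simp
qed

text \<open>
  The problems considered are promise problems, so the map need only be computed on a set \<open>D\<close> of
  admissible instances. The functions \<open>enc\<close> and \<open>enc'\<close> are the bit encodings of arguments and values.
\<close>

definition polytime_computable_on ::
  "'a set \<Rightarrow> ('a \<Rightarrow> bool list) \<Rightarrow> ('b \<Rightarrow> bool list) \<Rightarrow> ('a \<Rightarrow> 'b) \<Rightarrow> bool" where
  "polytime_computable_on D enc enc' f \<longleftrightarrow>
    (\<exists>(c :: com) (p :: nat poly). \<forall>x\<in>D. \<exists>t m.
        exec (enc x) c (\<lambda>_. 0, []) t (m, enc' (f x)) \<and> t \<le> poly p (length (enc x)))"


section \<open>Posets\<close>

definition antichain_on :: "'a rel \<Rightarrow> 'a set \<Rightarrow> bool" where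
  "antichain_on r S \<longleftrightarrow> (\<forall>a\<in>S. \<forall>b\<in>S. (a, b) \<in> r \<longrightarrow> a = b)"

definition poset_width :: "'a set \<Rightarrow> 'a rel \<Rightarrow> nat" where
  "poset_width A r = Max (card ` {S. S \<subseteq> A \<and> antichain_on r S})"

definition is_poset_iso :: "'a set \<Rightarrow> 'a rel \<Rightarrow> 'b set \<Rightarrow> 'b rel \<Rightarrow> ('a \<Rightarrow> 'b) \<Rightarrow> bool" where
  "is_poset_iso A r B s f \<longleftrightarrow>
    bij_betw f A B \<and> (\<forall>a\<in>A. \<forall>b\<in>A. (a, b) \<in> r \<longleftrightarrow> (f a, f b) \<in> s)"

text \<open>
  As inputs of an algorithm, finite posets and graphs have elements \<open>0, \<dots>, n - 1\<close> and are
  given as a pair \<open>(n, r)\<close>. The encoding is \<open>n\<close> in unary followed by the \<open>n \<times> n\<close> matrix of \<open>r\<close>.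
\<close>

fun encode_rel :: "nat \<times> nat rel \<Rightarrow> bool list" where
  "encode_rel (n, r) =
    replicate n True @ [False] @ concat (map (\<lambda>i. map (\<lambda>j. (i, j) \<in> r) [0..<n]) [0..<n])"

definition posets_of_width :: "nat \<Rightarrow> (nat \<times> nat rel) set" where
  "posets_of_width d = {(n, r). partial_order_on {..<n} r \<and> poset_width {..<n} r = d}"

fun poset_isomorphic :: "nat \<times> nat rel \<Rightarrow> nat \<times> nat rel \<Rightarrow> bool" where
  "poset_isomorphic (n, r) (m, s) \<longleftrightarrow> (\<exists>f. is_poset_iso {..<n} r {..<m} s f)"

text \<open>
  Colors are arbitrary bit strings, so that a color name may be exponentially large as a number.
  In the encoding every bit of a color is preceded by \<open>True\<close>, and \<open>False\<close> marks its end.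
  The coloring is a list, whose \<open>i\<close>-th entry is the color of the element \<open>i\<close>.
\<close>

type_synonym colored_poset = "(nat \<times> nat rel) \<times> bool list list"

definition encode_color :: "bool list \<Rightarrow> bool list" where
  "encode_color c = concat (map (\<lambda>b. [True, b]) c) @ [False]"

fun encode_colored :: "colored_poset \<Rightarrow> bool list" where
  "encode_colored (P, cs) = encode_rel P @ concat (map encode_color cs)"

definition colored_posets_of_width :: "nat \<Rightarrow> colored_poset set" where
  "colored_posets_of_width d = {(P, cs). P \<in> posets_of_width d \<and> length cs = fst P}"

fun colored_poset_isomorphic :: "colored_poset \<Rightarrow> colored_poset \<Rightarrow> bool" where
  "colored_poset_isomorphic ((n, r), cs) ((m, s), ds) \<longleftrightarrow>
    (\<exists>f. is_poset_iso {..<n} r {..<m} s f \<and> (\<forall>a<n. ds ! f a = cs ! a))"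


section \<open>\<open>H\<close>-graphs\<close>

text \<open>
  As in the imported library, an undirected simple graph is a symmetric loop-free digraph
  without parallel arcs (locale \<open>graph\<close>). Connected graphs are nonempty there.
  A subdivision of \<open>H\<close> has the same vertex type as \<open>H\<close>, so an infinite type is fixed for it.
\<close>

definition intersection_model ::
  "('a, 'b) pre_digraph \<Rightarrow> ('c, 'd) pre_digraph \<Rightarrow> ('a \<Rightarrow> ('c, 'd) pre_digraph) \<Rightarrow> bool" where
  "intersection_model G T M \<longleftrightarrow>
    (\<forall>v\<in>verts G. subgraph (M v) T \<and> connected (M v)) \<and>
    (\<forall>u\<in>verts G. \<forall>v\<in>verts G. u \<noteq> v \<longrightarrow>
        (u \<rightarrow>\<^bsub>G\<^esub> v \<longleftrightarrow> verts (M u) \<inter> verts (M v) \<noteq> {}))"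

definition H_graph :: "nat pair_pre_digraph \<Rightarrow> ('a, 'b) pre_digraph \<Rightarrow> bool" where
  "H_graph H G \<longleftrightarrow> graph G \<and>
    (\<exists>rev_H T rev_T M. subdivision (with_proj H, rev_H) (T, rev_T) \<and> intersection_model G T M)"

definition S_graph :: "nat \<Rightarrow> ('a, 'b) pre_digraph \<Rightarrow> bool" where
  "S_graph d G \<longleftrightarrow>
    (\<exists>S :: nat pair_pre_digraph. complete_bipartite_digraph 1 d (with_proj S) \<and> H_graph S G)"

fun graph_of :: "nat \<times> nat rel \<Rightarrow> (nat, nat \<times> nat) pre_digraph" where
  "graph_of (n, E) = with_proj \<lparr>pverts = {..<n}, parcs = E\<rparr>"

end

theory Submission
  imports Defs
begin

text \<open>
  For a poset \<open>P\<close> take a clique with a vertex \<open>u\<^sub>a\<close> for each element \<open>a\<close> and an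
  independent set of leaves, where the leaves of \<open>b\<close> are adjacent to \<open>u\<^sub>a\<close> iff \<open>b \<le> a\<close>. Then
  \<open>a \<le> b\<close> iff all leaves at \<open>u\<^sub>a\<close> are adjacent to \<open>u\<^sub>b\<close>, so the graph determines the poset. By
  Dilworth's theorem \<open>P\<close> is covered by \<open>d\<close> chains; placing the leaves of each chain along one ray
  of a star, the neighbors of \<open>u\<^sub>a\<close> form an initial segment of each ray, which yields the
  intersection model. Colors are reduced to three kinds of elements by replacing each element by a
  chain that spells out its color, which preserves the width, and the kind of an element is
  recorded by the number of its leaves.
\<close>

text \<open>Two demands shape the color gadget. Colors are bit strings, so a gadget as large as the
  number that a color denotes could be exponential; hence a color is spelled out with a bounded
  gadget per bit. The expansion of an element must not create new incomparable pairs, hence the bits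
  form a chain. The leaf counts 2, 3 and 4 stand for the bits False and True and for the end mark; a
  clique vertex needs at least two leaves to be told apart from a leaf. The end tokens have a second
  purpose. In the expanded order nothing but the leaf counts shows where one chain stops and the
  next begins. An end token is visible by its four leaves, and a token belongs to the element whose
  end token is the least one above it. The chain cover enters only the proof that the graph is an
  \<open>S_graph\<close>. The map does not search for one and does not depend on \<open>d\<close>,
  so one program serves every width. It also serves uncolored posets, read as posets in which all
  colors are empty.\<close>

section \<open>Subdivided stars\<close>

text \<open>
  The center is \<open>0\<close>, and \<open>i + 1 + d * p\<close> is the \<open>p\<close>-th vertex of the ray \<open>i < d\<close>, counted
  from the outer end. With this numbering each subdivision step appends a vertex next to the center.
\<close>

definition ray_edge :: "nat \<Rightarrow> nat \<Rightarrow> nat \<Rightarrow> nat \<Rightarrow> bool" where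
  "ray_edge d s u v \<longleftrightarrow> (1 \<le> u \<and> u \<le> s \<and> v = u + d) \<or> (u = 0 \<and> s < v \<and> v \<le> s + d)"

definition subdivided_star :: "nat \<Rightarrow> nat \<Rightarrow> nat pair_pre_digraph" where
  "subdivided_star d s = \<lparr>pverts = {..d + s}, parcs = {(u, v). ray_edge d s u v \<or> ray_edge d s v u}\<rparr>"

lemma complete_bipartite_subdivided_star:
  "complete_bipartite_digraph 1 d (with_proj (subdivided_star d 0))"
  unfolding complete_bipartite_digraph_pair_def
proof (intro conjI exI)
  show "pverts (subdivided_star d 0) = {0} \<union> {1..d}"
    by (auto simp: subdivided_star_def)
  show "parcs (subdivided_star d 0) = {0} \<times> {1..d} \<union> {1..d} \<times> {0}"
    by (auto simp: subdivided_star_def ray_edge_def)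
qed (auto simp: subdivided_star_def)

text \<open>The vertices next to the center are always \<open>s + 1\<close> to \<open>s + d\<close>.
  Subdividing at \<open>s + 1\<close> shifts this window by one, since the new vertex
  \<open>s + 1 + d\<close> takes over on the ray of \<open>s + 1\<close>. Without rays there is no
  such edge, hence \<open>0 < d\<close>.\<close>

lemma subdivide_subdivided_star:
  assumes "0 < d"
  shows "subdivide (subdivided_star d s) (0, s + 1) (s + 1 + d) = subdivided_star d (s + 1)"
proof -
  have "ray_edge d (s + 1) u v \<longleftrightarrow>
      ray_edge d s u v \<and> \<not> (u = 0 \<and> v = s + 1) \<or> v = s + 1 + d \<and> (u = 0 \<or> u = s + 1)" for u v
    using assms unfolding ray_edge_def by (cases "u = 0"; cases "v = s + 1 + d") auto
  moreover have "\<not> ray_edge d s (s + 1) 0"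
    by (simp add: ray_edge_def)
  ultimately show ?thesis
    by (auto simp: subdivide.simps subdivided_star_def)
qed

lemma subdivision_subdivided_star:
  assumes "d = 0 \<longrightarrow> s = 0"
  shows "subdivision_pair (subdivided_star d 0) (subdivided_star d s)"
  using assms
proof (induction s)
  case 0
  have "pair_graph (subdivided_star d 0)"
    using complete_bipartite_subdivided_star pair_graphI_complete_bipartite by blast
  then interpret pair_graph "subdivided_star d 0" .
  show ?case by (rule subdivision_pair_base) unfold_locales
next
  case (Suc s)
  then have "0 < d" by simp
  have "subdivision_pair (subdivided_star d 0) (subdivide (subdivided_star d s) (0, s + 1) (s + 1 + d))"
    using Suc \<open>0 < d\<close>
    by (intro subdivision_pair_divide) (auto simp: subdivided_star_def ray_edge_def)
  then show ?case unfolding subdivide_subdivided_star[OF \<open>0 < d\<close>] by (simp only: Suc_eq_plus1)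
qed

definition pair_induced :: "'a pair_pre_digraph \<Rightarrow> 'a set \<Rightarrow> 'a pair_pre_digraph" where
  "pair_induced T S = \<lparr>pverts = S, parcs = parcs T \<inter> S \<times> S\<rparr>"

lemma pair_induced_simps [simp]:
  "pverts (pair_induced T S) = S" "parcs (pair_induced T S) = parcs T \<inter> S \<times> S"
  by (simp_all add: pair_induced_def)

lemma subgraph_pair_induced:
  assumes "wf_digraph (with_proj T)" "S \<subseteq> pverts T"
  shows "subgraph (with_proj (pair_induced T S)) (with_proj T)"
  using assms by (auto simp: subgraph_def compatible_def wf_digraph_def)

lemma connected_single: "connected (with_proj (pair_induced T {v}))"
  by (auto simp: connected_def strongly_connected_def mk_symmetric_def reachable_def)

text \<open>Adding \<open>d\<close> moves one place inward along a ray, so a set closed under this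
  step contains with each vertex its whole path to the center.\<close>

lemma connected_toward_center:
  assumes "S \<subseteq> {..d + s}" "0 \<in> S" "0 < d"
    and closed: "\<And>v. v \<in> S \<Longrightarrow> v \<noteq> 0 \<Longrightarrow> v \<le> s \<Longrightarrow> v + d \<in> S"
  shows "connected (with_proj (pair_induced (subdivided_star d s) S))"
proof -
  let ?X = "with_proj (mk_symmetric (with_proj (pair_induced (subdivided_star d s) S)))"
  have adj: "(u, v) \<in> arcs_ends ?X" if "u \<in> S" "v \<in> S" "ray_edge d s u v \<or> ray_edge d s v u" for u v
    using that by (auto simp: mk_symmetric_def subdivided_star_def)
  have X: "wf_digraph ?X" by (auto simp: wf_digraph_def mk_symmetric_def)
  then interpret X: wf_digraph ?X .
  have V: "verts ?X = S" by (simp add: mk_symmetric_def)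
  have sym: "symmetric ?X"
    by (auto simp: symmetric_def mk_symmetric_def sym_def subdivided_star_def)
  have to0: "v \<rightarrow>\<^sup>*\<^bsub>?X\<^esub> 0" if "v \<in> S" for v
    using that
  \<comment> \<open>Inward steps increase the number of the vertex, so its distance to the largest
    number \<open>d + s\<close> drops.\<close>
  proof (induction "d + s - v" arbitrary: v rule: less_induct)
    case less
    consider "v = 0" | "v \<noteq> 0" "v \<le> s" | "s < v" by linarith
    then show ?case
    proof cases
      case 1
      then show ?thesis using \<open>0 \<in> S\<close> V by auto
    next
      case 2
      have "v \<rightarrow>\<^bsub>?X\<^esub> (v + d)"
        using 2 less.prems closed by (intro adj) (auto simp: ray_edge_def)
      moreover have "(v + d) \<rightarrow>\<^sup>*\<^bsub>?X\<^esub> 0"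
        using 2 less.prems closed \<open>0 < d\<close> by (intro less.hyps) auto
      ultimately show ?thesis by (rule X.adj_reachable_trans)
    next
      case 3
      have "v \<rightarrow>\<^bsub>?X\<^esub> 0"
        using 3 less.prems assms(1,2) by (intro adj) (auto simp: ray_edge_def)
      then show ?thesis by (rule X.reachable_adjI)
    qed
  qed
  have "u \<rightarrow>\<^sup>*\<^bsub>?X\<^esub> v" if "u \<in> S" "v \<in> S" for u v
    using to0[OF that(1)] symmetric_reachable[OF sym to0[OF that(2)]] by (rule X.reachable_trans)
  then show ?thesis
    unfolding connected_def strongly_connected_def using V \<open>0 \<in> S\<close> by auto
qed

text \<open>
  A vertex of the clique \<open>U\<close> is represented by the center together with an initial segment of each
  ray, a vertex outside \<open>U\<close> by a single point.
\<close>

lemma S_graph_split: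
  fixes G :: "('a, 'b) pre_digraph" and c q :: "'a \<Rightarrow> nat"
  assumes graph: "graph G" and U: "U \<subseteq> verts G"
    and clique: "\<And>u v. u \<in> U \<Longrightarrow> v \<in> U \<Longrightarrow> u \<noteq> v \<Longrightarrow> u \<rightarrow>\<^bsub>G\<^esub> v"
    and indep: "\<And>k l. k \<in> verts G - U \<Longrightarrow> l \<in> verts G - U \<Longrightarrow> \<not> k \<rightarrow>\<^bsub>G\<^esub> l"
    and c: "\<And>v. v \<in> verts G \<Longrightarrow> c v < d"
    and inj: "\<And>k l. k \<in> verts G - U \<Longrightarrow> l \<in> verts G - U \<Longrightarrow> c k = c l \<Longrightarrow> q k = q l \<Longrightarrow> k = l"
    and prefix: "\<And>u k l. u \<in> U \<Longrightarrow> k \<in> verts G - U \<Longrightarrow> l \<in> verts G - U \<Longrightarrow> k \<rightarrow>\<^bsub>G\<^esub> u \<Longrightarrow>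
      c k = c l \<Longrightarrow> q k \<le> q l \<Longrightarrow> l \<rightarrow>\<^bsub>G\<^esub> u"
  shows "S_graph d G"
proof -
  interpret graph G by fact
  define L where "L = verts G - U"
  \<comment> \<open>Place \<open>q l\<close> on the ray \<open>c l\<close>, in the numbering of
    \<open>subdivided_star\<close>.\<close>
  define pos where "pos l = 1 + c l + d * q l" for l
  \<comment> \<open>The sum is merely a common upper bound of the positions. With no rays nothing
    can be subdivided, so \<open>s\<close> has to be 0 then.\<close>
  define s where "s = (if d = 0 then 0 else \<Sum>l\<in>L. pos l)"
  define T where "T = subdivided_star d s"
  \<comment> \<open>The multiples of \<open>d\<close> run inward, so the segment reaches from the
    leaves adjacent to \<open>u\<close> to the center.\<close>
  define R where "R u = insert 0 {v \<in> {..d + s}. \<exists>l\<in>L. l \<rightarrow>\<^bsub>G\<^esub> u \<and> (\<exists>t. v = pos l + d * t)}" for u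
  define M where "M v = with_proj (pair_induced T (if v \<in> U then R v else {pos v}))" for v
  have "finite L" by (simp add: L_def)
  have LV: "l \<in> verts G" if "l \<in> L" for l using that by (simp add: L_def)
  have c': "c l < d" if "l \<in> L" for l using that c by (simp add: L_def)
  have pos_s: "pos l \<le> s" if "l \<in> L" for l
    using c'[OF that] member_le_sum[OF that, of pos] \<open>finite L\<close> by (auto simp: s_def)
  \<comment> \<open>The residue modulo \<open>d\<close> tells the ray because \<open>c\<close> stays
    below \<open>d\<close>; the quotient then tells the place.\<close>
  have pos_eq: "c l = c k \<and> q l = q k + t" if "k \<in> L" "l \<in> L" "pos l = pos k + d * t" for k l t
  proof -
    have *: "c l + d * q l = c k + d * (q k + t)"
      using that(3) by (simp add: pos_def algebra_simps)
    have "(c l + d * q l) mod d = c l" "(c k + d * (q k + t)) mod d = c k"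
      using that c' by simp_all
    then have "c l = c k" using * by simp
    with * c'[OF that(1)] show ?thesis by simp
  qed
  have subd: "subdivision_pair (subdivided_star d 0) T"
    unfolding T_def by (intro subdivision_subdivided_star) (simp add: s_def)
  then interpret T: pair_bidirected_digraph T
    by (rule bidirected_digraphI_subdivision)
  have wfT: "wf_digraph (with_proj T)" by unfold_locales
  have VT: "pverts T = {..d + s}" by (simp add: T_def subdivided_star_def)
  have vM: "verts (M v) = (if v \<in> U then R v else {pos v})" for v
    by (simp add: M_def)
  have sub: "subgraph (M v) (with_proj T)" if "v \<in> verts G" for v
    unfolding M_def
  proof (rule subgraph_pair_induced[OF wfT])
    have "pos v \<le> s" if "v \<notin> U" using pos_s that \<open>v \<in> verts G\<close> by (simp add: L_def)
    then show "(if v \<in> U then R v else {pos v}) \<subseteq> pverts T"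
      by (auto simp: VT R_def)
  qed
  have conn: "connected (M v)" if "v \<in> verts G" for v
  proof (cases "v \<in> U")
    case True
    \<comment> \<open>The bound on \<open>c\<close> covers the clique too, so the existence of any
      vertex makes \<open>d\<close> positive.\<close>
    have "0 < d" using c[OF that] by simp
    have "w + d \<in> R v" if "w \<in> R v" "w \<noteq> 0" "w \<le> s" for w
    proof -
      from that obtain l t where l: "l \<in> L" "l \<rightarrow>\<^bsub>G\<^esub> v" "w = pos l + d * t"
        by (auto simp: R_def)
      then have "w + d = pos l + d * (t + 1)" by simp
      with l(1,2) have "\<exists>l\<in>L. l \<rightarrow>\<^bsub>G\<^esub> v \<and> (\<exists>t. w + d = pos l + d * t)" by blast
      with that show ?thesis by (simp add: R_def)
    qed
    moreover have "R v \<subseteq> {..d + s}" "0 \<in> R v"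
      by (auto simp: R_def)
    ultimately have "connected (with_proj (pair_induced (subdivided_star d s) (R v)))"
      using \<open>0 < d\<close> by (intro connected_toward_center)
    with True show ?thesis by (simp only: M_def T_def if_True)
  next
    case False
    then show ?thesis by (simp add: M_def connected_single)
  qed
  have RL: "l \<rightarrow>\<^bsub>G\<^esub> u \<longleftrightarrow> pos l \<in> R u" if "u \<in> U" "l \<in> L" for u l
  proof
    assume "l \<rightarrow>\<^bsub>G\<^esub> u"
    moreover have "pos l = pos l + d * 0" by simp
    ultimately show "pos l \<in> R u"
      using that pos_s[OF that(2)] unfolding R_def by fastforce
  next
    assume "pos l \<in> R u"
    then obtain k t where k: "k \<in> L" "k \<rightarrow>\<^bsub>G\<^esub> u" "pos l = pos k + d * t"
      by (auto simp: R_def pos_def)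
    \<comment> \<open>The point of \<open>l\<close> was put into \<open>R u\<close> by a neighbor
      \<open>k\<close> of \<open>u\<close> on the same ray, at the same place or further out, and
      \<open>prefix\<close> passes adjacency inward.\<close>
    from pos_eq[OF k(1) that(2) k(3)] show "l \<rightarrow>\<^bsub>G\<^esub> u"
      using prefix[of u k l] that k by (auto simp: L_def)
  qed
  have model: "u \<rightarrow>\<^bsub>G\<^esub> v \<longleftrightarrow> verts (M u) \<inter> verts (M v) \<noteq> {}"
    if uv: "u \<in> verts G" "v \<in> verts G" "u \<noteq> v" for u v
  proof -
    consider "u \<in> U" "v \<in> U" | "u \<in> U" "v \<in> L" | "u \<in> L" "v \<in> U" | "u \<in> L" "v \<in> L"
      using uv by (auto simp: L_def)
    then show ?thesis
    proof cases
      case 1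
      then show ?thesis using clique uv by (auto simp: vM R_def)
    next
      case 2
      then have "u \<rightarrow>\<^bsub>G\<^esub> v \<longleftrightarrow> v \<rightarrow>\<^bsub>G\<^esub> u" using graph_symmetric by blast
      with 2 RL show ?thesis by (simp add: vM L_def)
    next
      case 3
      with RL show ?thesis by (simp add: vM L_def)
    next
      case 4
      then have "pos u \<noteq> pos v"
        using pos_eq[of v u 0] inj uv by (auto simp: L_def)
      with 4 indep show ?thesis by (simp add: vM L_def)
    qed
  qed
  have "intersection_model G (with_proj T) M"
    unfolding intersection_model_def using sub conn model by blast
  then have "H_graph (subdivided_star d 0) G"
    unfolding H_graph_def using graph subd by blast
  with complete_bipartite_subdivided_star show ?thesis
    unfolding S_graph_def by blast
qed

section \<open>Dilworth's theorem\<close>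

text \<open>The chains are the fibers of the labelling \<open>c\<close>, some possibly empty; the
  label of an element later becomes its ray.\<close>

definition chain_partition :: "'a rel \<Rightarrow> 'a set \<Rightarrow> nat \<Rightarrow> ('a \<Rightarrow> nat) \<Rightarrow> bool" where
  "chain_partition r A d c \<longleftrightarrow>
    c ` A \<subseteq> {..<d} \<and> (\<forall>a\<in>A. \<forall>b\<in>A. c a = c b \<longrightarrow> (a, b) \<in> r \<or> (b, a) \<in> r)"

lemma ex_maximal_element:
  assumes "finite A" "A \<noteq> {}" "trans r" "antisym r"
  obtains m where "m \<in> A" "\<And>x. x \<in> A \<Longrightarrow> (m, x) \<in> r \<Longrightarrow> x = m"
proof -
  have "\<exists>m\<in>A. \<forall>x\<in>A. (m, x) \<in> r \<longrightarrow> x = m"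
    using assms(1,2)
  proof (induction A rule: finite_ne_induct)
    case (insert a A)
    then obtain m where m: "m \<in> A" "\<forall>x\<in>A. (m, x) \<in> r \<longrightarrow> x = m" by blast
    show ?case
    proof (cases "(m, a) \<in> r")
      case True
      have "x = a" if "x \<in> A" "(a, x) \<in> r" for x
      proof -
        have "(m, x) \<in> r" using True that(2) \<open>trans r\<close> by (blast dest: transD)
        with m that have "x = m" by blast
        with True that(2) \<open>antisym r\<close> show ?thesis by (blast dest: antisymD)
      qed
      then show ?thesis by blast
    next
      case False
      with m show ?thesis by blast
    qed
  qed simp
  with that show thesis by blast
qed

text \<open>Galvin's proof: induction on the number of elements, removing a maximal element.\<close>

theorem dilworth:
  fixes r :: "'a rel"
  assumes "finite A" "refl_on A r" "trans r" "antisym r"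
    and "\<And>S. S \<subseteq> A \<Longrightarrow> antichain_on r S \<Longrightarrow> card S \<le> d"
  shows "\<exists>c. chain_partition r A d c"
  using assms(1,2,5)
proof (induction "card A" arbitrary: A d rule: less_induct)
  case less
  note fin = \<open>finite A\<close> and refl = \<open>refl_on A r\<close> and width = less.prems(3)
  show ?case
  proof (cases "A = {}")
    case True
    then show ?thesis by (intro exI[of _ "\<lambda>_. 0"]) (simp add: chain_partition_def)
  next
    case False
    obtain a where a: "a \<in> A" "\<And>x. x \<in> A \<Longrightarrow> (a, x) \<in> r \<Longrightarrow> x = a"
      using ex_maximal_element[OF fin False assms(3,4)] by blast
    define B where "B = A - {a}"
    have B: "finite B" "refl_on B r" "card B < card A" "B \<subseteq> A"
      using fin refl a(1) by (auto simp: B_def refl_on_def intro: card_Diff1_less simp del: card_Diff_insert card_Diff_singleton_if)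
    define W where "W = {S. S \<subseteq> B \<and> antichain_on r S}"
    have "finite W" using B(1) by (simp add: W_def)
    moreover have "{} \<in> W" by (simp add: W_def antichain_on_def)
    ultimately have Wc: "finite (card ` W)" "card ` W \<noteq> {}" by auto
    define k where "k = Max (card ` W)"
    from Max_in[OF Wc] obtain S0 where S0: "S0 \<subseteq> B" "antichain_on r S0" "card S0 = k"
      by (auto simp: k_def W_def)
    have k: "card S \<le> k" if "S \<subseteq> B" "antichain_on r S" for S
      using Max_ge[OF Wc(1), of "card S"] that by (auto simp: k_def W_def)
    obtain c where c: "chain_partition r B k c"
      using less.hyps[OF B(3,1,2) k] by blast
    have c_lt: "c x < k" if "x \<in> B" for x using c that by (auto simp: chain_partition_def)
    have chain: "(x, y) \<in> r \<or> (y, x) \<in> r" if "x \<in> B" "y \<in> B" "c x = c y" for x y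
      using c that by (auto simp: chain_partition_def)
    \<comment> \<open>Incomparable points of \<open>B\<close> have different labels, so
      \<open>k\<close> of them use all \<open>k\<close> labels.\<close>
    have hit: "\<exists>x\<in>S. c x = i" if S: "S \<subseteq> B" "antichain_on r S" "card S = k" and "i < k" for S i
    proof -
      have "inj_on c S"
        using S chain by (auto simp: inj_on_def antichain_on_def) (metis subsetD)
      then have "card (c ` S) = k" using S by (simp add: card_image)
      moreover have "c ` S \<subseteq> {..<k}" using S c_lt by auto
      ultimately have "c ` S = {..<k}" by (simp add: card_subset_eq)
      with \<open>i < k\<close> show ?thesis by (metis imageE lessThan_iff)
    qed
    \<comment> \<open>The \<open>x i\<close> chosen below is the highest point of chain
      \<open>i\<close> on a maximum antichain of \<open>B\<close>. These points again form an
      antichain, and they decide where \<open>a\<close> goes.\<close>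
    define Z where "Z i = {x \<in> B. c x = i \<and> (\<exists>S. S \<subseteq> B \<and> antichain_on r S \<and> card S = k \<and> x \<in> S)}" for i
    have "\<exists>x. x \<in> Z i \<and> (\<forall>y\<in>Z i. (x, y) \<in> r \<longrightarrow> y = x)" if "i < k" for i
    proof -
      have "finite (Z i)" using B(1) by (simp add: Z_def)
      moreover have "Z i \<noteq> {}" using hit[OF S0 that] S0 by (auto simp: Z_def)
      ultimately show ?thesis using ex_maximal_element[OF _ _ assms(3,4)] by metis
    qed
    then obtain x where x: "\<And>i. i < k \<Longrightarrow> x i \<in> Z i" "\<And>i y. i < k \<Longrightarrow> y \<in> Z i \<Longrightarrow> (x i, y) \<in> r \<Longrightarrow> y = x i"
      by metis
    have x': "x i \<in> B" "c (x i) = i" if "i < k" for i using x(1)[OF that] by (auto simp: Z_def)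
    \<comment> \<open>Inside a chain a maximal element is the greatest.\<close>
    have top: "(y, x i) \<in> r" if "i < k" "y \<in> Z i" for i y
      using chain[of y "x i"] x(2)[OF that] x'[OF that(1)] that(2) by (auto simp: Z_def)
    \<comment> \<open>If \<open>x i\<close> is below \<open>x j\<close>, a maximum antichain through
      \<open>x j\<close> meets chain \<open>i\<close> in some \<open>y\<close> below
      \<open>x i\<close>, hence below \<open>x j\<close>. So \<open>y = x j\<close>, and
      \<open>x j\<close> is below \<open>x i\<close> as well.\<close>
    have anti: "antichain_on r (x ` {..<k})"
      unfolding antichain_on_def
    proof (clarify, rule ccontr)
      fix i j assume ij: "i < k" "j < k" "(x i, x j) \<in> r" "x i \<noteq> x j"
      obtain S where S: "S \<subseteq> B" "antichain_on r S" "card S = k" "x j \<in> S"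
        using x(1)[OF ij(2)] by (auto simp: Z_def)
      obtain y where y: "y \<in> S" "c y = i" using hit[OF S(1-3) ij(1)] by blast
      then have "y \<in> Z i" using S by (auto simp: Z_def)
      from top[OF ij(1) this] ij(3) have "(y, x j) \<in> r" using \<open>trans r\<close> by (blast dest: transD)
      then have "y = x j" using S y by (auto simp: antichain_on_def)
      with top[OF ij(1) \<open>y \<in> Z i\<close>] ij \<open>antisym r\<close> show False by (blast dest: antisymD)
    qed
    have cardX: "card (x ` {..<k}) = k"
    proof -
      have "inj_on x {..<k}" by (rule inj_on_inverseI[of _ c]) (simp add: x')
      then show ?thesis by (simp add: card_image)
    qed
    show ?thesis
    proof (cases "\<exists>i<k. (x i, a) \<in> r")
      \<comment> \<open>Now \<open>a\<close>, being maximal, is incomparable to every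
        \<open>x i\<close>. The enlarged antichain shows \<open>k < d\<close>, which leaves the
        label \<open>k\<close> free for \<open>a\<close> alone.\<close>
      case False
      have "antichain_on r (insert a (x ` {..<k}))"
        using anti False x' B(4) unfolding antichain_on_def by (auto dest!: a(2)[rotated])
      moreover have "insert a (x ` {..<k}) \<subseteq> A" using a(1) x' B(4) by auto
      ultimately have "card (insert a (x ` {..<k})) \<le> d" by (rule width[rotated])
      moreover have "a \<notin> x ` {..<k}" using x' by (auto simp: B_def)
      ultimately have "k < d" using cardX by (simp add: card_insert_if)
      have "chain_partition r A d (c(a := k))"
        unfolding chain_partition_def
      proof (intro conjI ballI impI)
        show "(c(a := k)) ` A \<subseteq> {..<d}"
          using \<open>k < d\<close> c_lt by (fastforce simp: B_def)
        fix u v assume uv: "u \<in> A" "v \<in> A" "(c(a := k)) u = (c(a := k)) v"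
        then show "(u, v) \<in> r \<or> (v, u) \<in> r"
          using chain[of u v] c_lt[of u] c_lt[of v] refl
          by (auto simp: B_def refl_on_def split: if_splits)
      qed
      then show ?thesis by blast
    next
      case True
      then obtain i where i: "i < k" "(x i, a) \<in> r" by blast
      \<comment> \<open>This set is a chain with \<open>a\<close> on top. Its removal destroys all
        antichains of size \<open>k\<close>, so the rest needs only \<open>k - 1\<close>
        labels.\<close>
      define K where "K = insert a {z \<in> B. c z = i \<and> (z, x i) \<in> r}"
      have K: "(u, v) \<in> r \<or> (v, u) \<in> r" if "u \<in> K" "v \<in> K" for u v
      proof -
        have "(z, a) \<in> r" if "z \<in> K" for z
        proof (cases "z = a")
          case True
          with refl a(1) show ?thesis by (simp add: refl_on_def)
        next
          case False
          with that have "(z, x i) \<in> r" by (simp add: K_def)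
          with i(2) \<open>trans r\<close> show ?thesis by (blast dest: transD)
        qed
        with that chain[of u v] show ?thesis by (auto simp: K_def)
      qed
      \<comment> \<open>An antichain of size \<open>k\<close> avoiding \<open>K\<close> would meet
        chain \<open>i\<close> in a point of \<open>Z i\<close>; that point lies below
        \<open>x i\<close>, hence in \<open>K\<close>.\<close>
      have "card S \<le> k - 1" if S: "S \<subseteq> A - K" "antichain_on r S" for S
      proof -
        have SB: "S \<subseteq> B" using S by (auto simp: B_def K_def)
        have "card S \<noteq> k"
        proof
          assume "card S = k"
          from hit[OF SB S(2) this i(1)] obtain y where y: "y \<in> S" "c y = i" by blast
          then have "y \<in> Z i" using SB S \<open>card S = k\<close> by (auto simp: Z_def)
          from top[OF i(1) this] y SB have "y \<in> K" by (auto simp: K_def)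
          with y S show False by auto
        qed
        with k[OF SB S(2)] show ?thesis by simp
      qed
      moreover have "card (A - K) < card A"
        using fin a(1) by (intro psubset_card_mono) (auto simp: K_def)
      moreover have "finite (A - K)" "refl_on (A - K) r"
        using fin refl by (auto simp: refl_on_def)
      ultimately obtain c' where c': "chain_partition r (A - K) (k - 1) c'"
        using less.hyps[of "A - K" "k - 1"] by blast
      have "k \<le> d" using width[of S0] S0 B(4) by auto
      have "chain_partition r A d (\<lambda>z. if z \<in> K then k - 1 else c' z)"
        unfolding chain_partition_def
      proof (intro conjI ballI impI)
        show "(\<lambda>z. if z \<in> K then k - 1 else c' z) ` A \<subseteq> {..<d}"
          using c' i(1) \<open>k \<le> d\<close> by (fastforce simp: chain_partition_def)
        fix u v assume uv: "u \<in> A" "v \<in> A"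
          "(if u \<in> K then k - 1 else c' u) = (if v \<in> K then k - 1 else c' v)"
        show "(u, v) \<in> r \<or> (v, u) \<in> r"
        proof (cases "u \<in> K"; cases "v \<in> K")
          assume "u \<in> K" "v \<in> K"
          then show ?thesis using K by blast
        next
          assume "u \<notin> K" "v \<notin> K"
          then show ?thesis using c' uv by (simp add: chain_partition_def)
        next
          assume "u \<in> K" "v \<notin> K"
          then have "c' v < k - 1" using c' uv(2) by (auto simp: chain_partition_def)
          with uv(3) \<open>u \<in> K\<close> \<open>v \<notin> K\<close> show ?thesis by simp
        next
          assume "u \<notin> K" "v \<in> K"
          then have "c' u < k - 1" using c' uv(1) by (auto simp: chain_partition_def)
          with uv(3) \<open>u \<notin> K\<close> \<open>v \<in> K\<close> show ?thesis by simp
        qed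
      qed
      then show ?thesis by blast
    qed
  qed
qed

lemma chain_partition_of_width:
  assumes "(n, r) \<in> posets_of_width d"
  shows "\<exists>c. chain_partition r {..<n} d c"
proof (rule dilworth)
  have po: "partial_order_on {..<n} r" "poset_width {..<n} r = d"
    using assms by (auto simp: posets_of_width_def)
  then show "refl_on {..<n} r" "trans r" "antisym r"
    by (auto dest: partial_order_onD)
  show "card S \<le> d" if "S \<subseteq> {..<n}" "antichain_on r S" for S
    using that po(2) unfolding poset_width_def by (auto intro: Max_ge)
qed simp

section \<open>The split graph of a colored poset\<close>

text \<open>
  The element \<open>i\<close> is replaced by a chain of tokens \<open>(i, j)\<close>, one for each bit of its color followed by
  an end token. Each token has one clique vertex \<open>(i, j, 0)\<close> and \<open>leaves\<close> many twin leaves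
  \<open>(i, j, k)\<close>, whose number tells the bits and the end token apart.
\<close>

definition leaves :: "bool list \<Rightarrow> nat \<Rightarrow> nat" where
  "leaves c j = (if j < length c then (if c ! j then 3 else 2) else 4)"

definition token_vertices :: "nat \<Rightarrow> bool list \<Rightarrow> nat \<Rightarrow> (nat \<times> nat \<times> nat) list" where
  "token_vertices i c j = map (\<lambda>k. (i, j, k)) [0..<Suc (leaves c j)]"

definition vertex_list :: "bool list list \<Rightarrow> (nat \<times> nat \<times> nat) list" where
  "vertex_list cs = concat (map (\<lambda>i. concat (map (token_vertices i (cs ! i)) [0..<Suc (length (cs ! i))])) [0..<length cs])"

text \<open>The lexicographic sum of the chains over the poset. The guard
  \<open>i \<noteq> i'\<close> matters because \<open>r\<close> is reflexive: without it any two
  tokens of one element would lie below each other.\<close>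

fun token_le :: "nat rel \<Rightarrow> nat \<times> nat \<Rightarrow> nat \<times> nat \<Rightarrow> bool" where
  "token_le r (i, j) (i', j') \<longleftrightarrow> (i = i' \<and> j \<le> j') \<or> (i \<noteq> i' \<and> (i, i') \<in> r)"

fun split_adj :: "nat rel \<Rightarrow> nat \<times> nat \<times> nat \<Rightarrow> nat \<times> nat \<times> nat \<Rightarrow> bool" where
  "split_adj r (i, j, k) (i', j', k') \<longleftrightarrow>
    (k = 0 \<and> k' = 0 \<and> (i, j) \<noteq> (i', j')) \<or>
    (k = 0 \<and> k' \<noteq> 0 \<and> token_le r (i', j') (i, j)) \<or>
    (k \<noteq> 0 \<and> k' = 0 \<and> token_le r (i, j) (i', j'))"

fun split_graph :: "colored_poset \<Rightarrow> nat \<times> nat rel" where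
  "split_graph ((n, r), cs) =
    (let vs = vertex_list cs in
      (length vs, {(a, b). a < length vs \<and> b < length vs \<and> split_adj r (vs ! a) (vs ! b)}))"

lemma set_vertex_list:
  "(i, j, k) \<in> set (vertex_list cs) \<longleftrightarrow> i < length cs \<and> j \<le> length (cs ! i) \<and> k \<le> leaves (cs ! i) j"
  by (force simp: vertex_list_def token_vertices_def less_Suc_eq_le simp del: upt_Suc)

text \<open>The function \<open>g\<close> reads off an entry which block it comes from, so different
  blocks are disjoint.\<close>

lemma distinct_concat_map:
  assumes "distinct xs" "\<And>x. x \<in> set xs \<Longrightarrow> distinct (f x)"
    and "\<And>x v. x \<in> set xs \<Longrightarrow> v \<in> set (f x) \<Longrightarrow> g v = x"
  shows "distinct (concat (map f xs))"
  using assms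
proof (induction xs)
  case (Cons x xs)
  have "distinct (concat (map f xs))" using Cons by auto
  moreover have "set (f x) \<inter> set (concat (map f xs)) = {}"
  proof (rule ccontr)
    assume "set (f x) \<inter> set (concat (map f xs)) \<noteq> {}"
    then obtain v y where "v \<in> set (f x)" "y \<in> set xs" "v \<in> set (f y)" by auto
    with Cons.prems(3)[of x v] Cons.prems(3)[of y v] Cons.prems(1) show False by auto
  qed
  ultimately show ?case using Cons.prems by simp
qed simp

lemma distinct_vertex_list: "distinct (vertex_list cs)"
  unfolding vertex_list_def
proof (rule distinct_concat_map[where g = fst])
  fix i assume "i \<in> set [0..<length cs]"
  show "distinct (concat (map (token_vertices i (cs ! i)) [0..<Suc (length (cs ! i))]))"
    by (rule distinct_concat_map[where g = "fst \<circ> snd"])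
      (auto simp: token_vertices_def distinct_map inj_on_def simp del: upt_Suc)
qed (auto simp: token_vertices_def simp del: upt_Suc)

lemma bij_betw_vertex_list:
  "bij_betw (nth (vertex_list cs)) {..<length (vertex_list cs)} (set (vertex_list cs))"
  using distinct_vertex_list by (intro bij_betw_nth) auto

lemma split_adj_commute: "split_adj r v w \<longleftrightarrow> split_adj r w v"
  by (cases v; cases w) auto

lemma split_adj_irrefl: "\<not> split_adj r v v"
  by (cases v) auto

section \<open>Isomorphism of the numbered graphs in terms of their vertex triples\<close>

lemma graph_graph_of:
  assumes "E \<subseteq> {..<N} \<times> {..<N}" "sym E" "irrefl E"
  shows "graph (graph_of (N, E))"
proof -
  have "finite E" using assms(1) by (rule finite_subset) auto
  with assms show ?thesis
    by unfold_locales (auto simp: arc_to_ends_def symmetric_def irrefl_def)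
qed

lemma graph_split_graph: "graph (graph_of (split_graph P))"
proof (cases P rule: split_graph.cases)
  case (1 n r cs)
  show ?thesis
    unfolding 1 split_graph.simps Let_def
    by (rule graph_graph_of)
      (auto simp: sym_def irrefl_def split_adj_irrefl, auto simp: split_adj_commute)
qed

text \<open>Arcs are pairs with tail \<open>fst\<close> and head \<open>snd\<close> on both sides,
  so the arc component of a digraph isomorphism is forced to be \<open>map_prod f f\<close> on the
  arcs. What remains is a bijection respecting the relation, and \<open>is_poset_iso\<close> says
  this for arbitrary relations.\<close>

lemma digraph_iso_graph_of_iff:
  assumes "E \<subseteq> {..<N} \<times> {..<N}" "E' \<subseteq> {..<N'} \<times> {..<N'}"
  shows "digraph_iso (graph_of (N, E)) (graph_of (N', E')) \<longleftrightarrow> (\<exists>f. is_poset_iso {..<N} E {..<N'} E' f)"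
proof
  assume "digraph_iso (graph_of (N, E)) (graph_of (N', E'))"
  then obtain h where h: "pre_digraph.digraph_isomorphism (graph_of (N, E)) h"
      "graph_of (N', E') = app_iso h (graph_of (N, E))"
    by (auto simp: digraph_iso_def)
  define f where "f = iso_verts h"
  have "verts (graph_of (N', E')) = f ` {..<N}" "arcs (graph_of (N', E')) = iso_arcs h ` E"
      "tail (graph_of (N', E')) = iso_tail h" "head (graph_of (N', E')) = iso_head h"
    unfolding h(2) by (simp_all add: f_def)
  then have eqs: "{..<N'} = f ` {..<N}" "E' = iso_arcs h ` E" "iso_tail h = fst" "iso_head h = snd"
    by simp_all
  have inj: "inj_on f {..<N}" and arc: "\<And>a b. (a, b) \<in> E \<Longrightarrow> iso_arcs h (a, b) = (f a, f b)"
    using h(1) eqs(3,4) by (auto simp: pre_digraph.digraph_isomorphism_def f_def prod_eq_iff)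
  have "(a, b) \<in> E \<longleftrightarrow> (f a, f b) \<in> E'" if "a < N" "b < N" for a b
  proof
    assume "(a, b) \<in> E"
    then show "(f a, f b) \<in> E'" using arc eqs(2) by (metis imageI)
  next
    assume "(f a, f b) \<in> E'"
    then obtain a' b' where ab: "(a', b') \<in> E" "(f a', f b') = (f a, f b)"
      using arc eqs(2) by (metis imageE surj_pair)
    then have "a' = a" "b' = b" using inj that assms(1) by (auto dest: inj_onD)
    with ab show "(a, b) \<in> E" by simp
  qed
  with inj eqs(1) have "is_poset_iso {..<N} E {..<N'} E' f"
    by (simp add: is_poset_iso_def bij_betw_def)
  then show "\<exists>f. is_poset_iso {..<N} E {..<N'} E' f" by blast
next
  assume "\<exists>f. is_poset_iso {..<N} E {..<N'} E' f"
  then obtain f where f: "bij_betw f {..<N} {..<N'}"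
      "\<And>a b. a < N \<Longrightarrow> b < N \<Longrightarrow> (a, b) \<in> E \<longleftrightarrow> (f a, f b) \<in> E'"
    by (auto simp: is_poset_iso_def)
  define h where "h = \<lparr>iso_verts = f, iso_arcs = map_prod f f, iso_head = snd, iso_tail = fst\<rparr>"
  have inj: "inj_on f {..<N}" and im: "f ` {..<N} = {..<N'}"
    using f(1) by (auto simp: bij_betw_def)
  have "wf_digraph (graph_of (N, E))" using assms(1) by (auto simp: wf_digraph_def)
  moreover have "inj_on (map_prod f f) E"
    by (rule inj_on_subset[OF map_prod_inj_on[OF inj inj] assms(1)])
  ultimately have "pre_digraph.digraph_isomorphism (graph_of (N, E)) h"
    using inj by (auto simp: pre_digraph.digraph_isomorphism_def h_def)
  moreover have "E' = map_prod f f ` E"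
  proof (intro equalityI subsetI)
    fix e assume "e \<in> E'"
    with assms(2) im obtain a b where "e = (f a, f b)" "a < N" "b < N" by blast
    with f(2) \<open>e \<in> E'\<close> show "e \<in> map_prod f f ` E" by force
  qed (use f(2) assms(1) in auto)
  then have "graph_of (N', E') = app_iso h (graph_of (N, E))"
    using im by (simp add: app_iso_def h_def with_proj_def)
  ultimately show "digraph_iso (graph_of (N, E)) (graph_of (N', E'))"
    unfolding digraph_iso_def by blast
qed

definition split_iso ::
  "nat rel \<Rightarrow> bool list list \<Rightarrow> nat rel \<Rightarrow> bool list list \<Rightarrow> (nat \<times> nat \<times> nat \<Rightarrow> nat \<times> nat \<times> nat) \<Rightarrow> bool" where
  "split_iso r cs s ds \<phi> \<longleftrightarrow>
    bij_betw \<phi> (set (vertex_list cs)) (set (vertex_list ds)) \<and>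
    (\<forall>v\<in>set (vertex_list cs). \<forall>w\<in>set (vertex_list cs). split_adj r v w \<longleftrightarrow> split_adj s (\<phi> v) (\<phi> w))"

text \<open>The vertex lists are distinct, so they enumerate the triples bijectively; the two kinds
  of isomorphism are conjugate under these enumerations.\<close>

lemma digraph_iso_split_graph_iff:
  "digraph_iso (graph_of (split_graph ((n, r), cs))) (graph_of (split_graph ((m, s), ds)))
    \<longleftrightarrow> (\<exists>\<phi>. split_iso r cs s ds \<phi>)"
proof -
  define vs where "vs = vertex_list cs"
  define ws where "ws = vertex_list ds"
  let ?I = "{..<length vs}" and ?J = "{..<length ws}"
  define E where "E = {(a, b). a \<in> ?I \<and> b \<in> ?I \<and> split_adj r (vs ! a) (vs ! b)}"
  define E' where "E' = {(a, b). a \<in> ?J \<and> b \<in> ?J \<and> split_adj s (ws ! a) (ws ! b)}"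
  have "split_graph ((n, r), cs) = (length vs, E)" "split_graph ((m, s), ds) = (length ws, E')"
    by (simp_all add: vs_def ws_def E_def E'_def Let_def)
  moreover have "E \<subseteq> ?I \<times> ?I" "E' \<subseteq> ?J \<times> ?J"
    by (auto simp: E_def E'_def)
  moreover have "(\<exists>f. is_poset_iso ?I E ?J E' f) \<longleftrightarrow> (\<exists>\<phi>. split_iso r cs s ds \<phi>)"
  proof -
    have vs: "bij_betw (nth vs) ?I (set vs)" and ws: "bij_betw (nth ws) ?J (set ws)"
      using bij_betw_vertex_list by (simp_all add: vs_def ws_def)
    let ?vi = "inv_into ?I (nth vs)" and ?wi = "inv_into ?J (nth ws)"
    have vi: "?vi v \<in> ?I" "vs ! ?vi v = v" if "v \<in> set vs" for v
      using that bij_betw_inv_into_right[OF vs] bij_betw_apply[OF bij_betw_inv_into[OF vs]] by auto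
    have wi: "?wi v \<in> ?J" "ws ! ?wi v = v" if "v \<in> set ws" for v
      using that bij_betw_inv_into_right[OF ws] bij_betw_apply[OF bij_betw_inv_into[OF ws]] by auto
    show ?thesis
    proof
      assume "\<exists>f. is_poset_iso ?I E ?J E' f"
      then obtain f where f: "bij_betw f ?I ?J"
          "\<And>a b. a \<in> ?I \<Longrightarrow> b \<in> ?I \<Longrightarrow> (a, b) \<in> E \<longleftrightarrow> (f a, f b) \<in> E'"
        by (auto simp: is_poset_iso_def)
      have "bij_betw (nth ws \<circ> f \<circ> ?vi) (set vs) (set ws)"
        using bij_betw_inv_into[OF vs] f(1) ws by (intro bij_betw_trans)
      moreover have "split_adj r v w \<longleftrightarrow> split_adj s ((nth ws \<circ> f \<circ> ?vi) v) ((nth ws \<circ> f \<circ> ?vi) w)"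
        if "v \<in> set vs" "w \<in> set vs" for v w
        using f(2)[OF vi(1)[OF that(1)] vi(1)[OF that(2)]] vi[OF that(1)] vi[OF that(2)]
          bij_betw_apply[OF f(1)] by (auto simp: E_def E'_def)
      ultimately show "\<exists>\<phi>. split_iso r cs s ds \<phi>"
        unfolding split_iso_def vs_def[symmetric] ws_def[symmetric] by blast
    next
      assume "\<exists>\<phi>. split_iso r cs s ds \<phi>"
      then obtain \<phi> where \<phi>: "bij_betw \<phi> (set vs) (set ws)"
          "\<And>v w. v \<in> set vs \<Longrightarrow> w \<in> set vs \<Longrightarrow> split_adj r v w \<longleftrightarrow> split_adj s (\<phi> v) (\<phi> w)"
        by (auto simp: split_iso_def vs_def ws_def)
      have "bij_betw (?wi \<circ> \<phi> \<circ> nth vs) ?I ?J"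
        using vs \<phi>(1) bij_betw_inv_into[OF ws] by (intro bij_betw_trans)
      moreover have "(a, b) \<in> E \<longleftrightarrow> ((?wi \<circ> \<phi> \<circ> nth vs) a, (?wi \<circ> \<phi> \<circ> nth vs) b) \<in> E'"
        if "a \<in> ?I" "b \<in> ?I" for a b
        using that \<phi>(2)[of "vs ! a" "vs ! b"] wi[of "\<phi> (vs ! a)"] wi[of "\<phi> (vs ! b)"]
          bij_betw_apply[OF \<phi>(1)] by (auto simp: E_def E'_def)
      ultimately show "\<exists>f. is_poset_iso ?I E ?J E' f"
        unfolding is_poset_iso_def by blast
    qed
  qed
  ultimately show ?thesis by (simp only: digraph_iso_graph_of_iff)
qed

section \<open>Tokens, their order and their leaf counts recovered from the graph\<close>

lemma two_le_leaves: "2 \<le> leaves c j"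
  by (simp add: leaves_def)

text \<open>
  Two of its own leaves are nonadjacent neighbors of a clique vertex, whereas all neighbors of a leaf
  are in the clique. Hence isomorphisms preserve the clique.
\<close>

lemma clique_vertex_iff:
  assumes "v \<in> set (vertex_list cs)"
  shows "snd (snd v) = 0 \<longleftrightarrow> (\<exists>a\<in>set (vertex_list cs). \<exists>b\<in>set (vertex_list cs).
    a \<noteq> b \<and> split_adj r v a \<and> split_adj r v b \<and> \<not> split_adj r a b)"
proof -
  obtain i j k where v: "v = (i, j, k)" by (cases v)
  show ?thesis
  proof
    assume "snd (snd v) = 0"
    with assms two_le_leaves[of "cs ! i" j] show "\<exists>a\<in>set (vertex_list cs). \<exists>b\<in>set (vertex_list cs).
        a \<noteq> b \<and> split_adj r v a \<and> split_adj r v b \<and> \<not> split_adj r a b"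
      by (intro bexI[of _ "(i, j, 1)"] bexI[of _ "(i, j, 2)"]) (auto simp: v set_vertex_list)
  next
    assume "\<exists>a\<in>set (vertex_list cs). \<exists>b\<in>set (vertex_list cs).
        a \<noteq> b \<and> split_adj r v a \<and> split_adj r v b \<and> \<not> split_adj r a b"
    then show "snd (snd v) = 0" by (auto simp: v)
  qed
qed

definition tokens :: "bool list list \<Rightarrow> (nat \<times> nat) set" where
  "tokens cs = {(i, j). i < length cs \<and> j \<le> length (cs ! i)}"

definition vertex_of :: "nat \<times> nat \<Rightarrow> nat \<Rightarrow> nat \<times> nat \<times> nat" where
  "vertex_of e k = (fst e, snd e, k)"

definition token_leaves :: "bool list list \<Rightarrow> nat \<times> nat \<Rightarrow> nat" where
  "token_leaves cs e = leaves (cs ! fst e) (snd e)"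

lemma vertex_of_in_iff: "vertex_of e k \<in> set (vertex_list cs) \<longleftrightarrow> e \<in> tokens cs \<and> k \<le> token_leaves cs e"
  by (cases e) (auto simp: vertex_of_def tokens_def token_leaves_def set_vertex_list)

lemma vertex_cases:
  assumes "v \<in> set (vertex_list cs)"
  obtains e k where "v = vertex_of e k" "e \<in> tokens cs" "k \<le> token_leaves cs e"
  using assms that[of "(fst v, fst (snd v))" "snd (snd v)"] vertex_of_in_iff[of "(fst v, fst (snd v))" "snd (snd v)" cs]
  by (simp add: vertex_of_def)

lemma vertex_of_eq_iff [simp]: "vertex_of e k = vertex_of e' k' \<longleftrightarrow> e = e' \<and> k = k'"
  by (auto simp: vertex_of_def prod_eq_iff)

lemma snd_snd_vertex_of [simp]: "snd (snd (vertex_of e k)) = k"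
  by (simp add: vertex_of_def)

lemma split_adj_vertex_of [simp]:
  "split_adj r (vertex_of e k) (vertex_of e' k') \<longleftrightarrow>
    k = 0 \<and> k' = 0 \<and> e \<noteq> e' \<or> k = 0 \<and> k' \<noteq> 0 \<and> token_le r e' e \<or> k \<noteq> 0 \<and> k' = 0 \<and> token_le r e e'"
  by (cases e; cases e') (auto simp: vertex_of_def)

lemma token_le_refl [simp]: "token_le r e e"
  by (cases e) auto

lemma token_le_trans:
  assumes "trans r" "antisym r" "token_le r e1 e2" "token_le r e2 e3"
  shows "token_le r e1 e3"
  using assms by (cases e1; cases e2; cases e3) (auto dest: transD antisymD)

lemma token_le_antisym:
  assumes "antisym r" "token_le r e1 e2" "token_le r e2 e1"
  shows "e1 = e2"
  using assms by (cases e1; cases e2) (auto dest: antisymD)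

lemma token_le_iff_leaves:
  assumes "trans r" "antisym r" "e \<in> tokens cs" "e' \<in> tokens cs"
  shows "token_le r e e' \<longleftrightarrow> (\<forall>l\<in>set (vertex_list cs). snd (snd l) \<noteq> 0 \<longrightarrow>
    split_adj r l (vertex_of e 0) \<longrightarrow> split_adj r l (vertex_of e' 0))" (is "_ \<longleftrightarrow> ?R")
proof
  assume le: "token_le r e e'"
  show ?R
  proof (intro ballI impI)
    fix l assume l: "l \<in> set (vertex_list cs)" "snd (snd l) \<noteq> 0" "split_adj r l (vertex_of e 0)"
    from l(1) obtain e1 k where "l = vertex_of e1 k" by (rule vertex_cases)
    with l(2,3) token_le_trans[OF assms(1,2) _ le] show "split_adj r l (vertex_of e' 0)" by simp
  qed
next
  assume R: ?R
  \<comment> \<open>One leaf of \<open>e\<close> itself suffices as a test for the converse.\<close>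
  have "vertex_of e 1 \<in> set (vertex_list cs)"
    using assms(3) two_le_leaves[of "cs ! fst e" "snd e"] by (simp add: vertex_of_in_iff token_leaves_def)
  with R have "split_adj r (vertex_of e 1) (vertex_of e 0) \<longrightarrow> split_adj r (vertex_of e 1) (vertex_of e' 0)"
    by (auto simp: vertex_of_def)
  then show "token_le r e e'" by simp
qed

text \<open>The neighborhood of a leaf in the clique is the up-set of its token, and by antisymmetry
  different tokens have different up-sets. So the leaf count is determined by adjacency and order
  alone.\<close>

lemma token_leaves_eq_card:
  assumes "antisym r" "e \<in> tokens cs"
  shows "token_leaves cs e = card {l \<in> set (vertex_list cs). snd (snd l) \<noteq> 0 \<and>
    (\<forall>e'\<in>tokens cs. split_adj r l (vertex_of e' 0) \<longleftrightarrow> token_le r e e')}" (is "_ = card ?S")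
proof -
  have "?S = vertex_of e ` {1..token_leaves cs e}"
  proof (intro equalityI subsetI)
    fix l assume l: "l \<in> ?S"
    then have "l \<in> set (vertex_list cs)" by simp
    then obtain e1 k where k: "l = vertex_of e1 k" "e1 \<in> tokens cs" "k \<le> token_leaves cs e1"
      by (rule vertex_cases)
    have "k \<noteq> 0" using l k by (simp add: vertex_of_def)
    with l k have "token_le r e1 e' \<longleftrightarrow> token_le r e e'" if "e' \<in> tokens cs" for e'
      using that by auto
    from this[OF assms(2)] this[OF k(2)] have "token_le r e1 e" "token_le r e e1" by simp_all
    with assms(1) have "e1 = e" by (intro token_le_antisym)
    with k \<open>k \<noteq> 0\<close> show "l \<in> vertex_of e ` {1..token_leaves cs e}" by simp
  next
    fix l assume "l \<in> vertex_of e ` {1..token_leaves cs e}"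
    with assms(2) show "l \<in> ?S" by (auto simp: vertex_of_in_iff)
  qed
  moreover have "inj_on (vertex_of e) {1..token_leaves cs e}" by (simp add: inj_on_def)
  ultimately show ?thesis by (simp add: card_image)
qed

definition token_map :: "(nat \<times> nat \<times> nat \<Rightarrow> nat \<times> nat \<times> nat) \<Rightarrow> nat \<times> nat \<Rightarrow> nat \<times> nat" where
  "token_map \<phi> e = (fst (\<phi> (vertex_of e 0)), fst (snd (\<phi> (vertex_of e 0))))"

definition token_iso :: "nat rel \<Rightarrow> bool list list \<Rightarrow> nat rel \<Rightarrow> bool list list \<Rightarrow> (nat \<times> nat \<Rightarrow> nat \<times> nat) \<Rightarrow> bool" where
  "token_iso r cs s ds g \<longleftrightarrow> bij_betw g (tokens cs) (tokens ds) \<and>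
    (\<forall>e\<in>tokens cs. \<forall>e'\<in>tokens cs. token_le r e e' \<longleftrightarrow> token_le s (g e) (g e')) \<and>
    (\<forall>e\<in>tokens cs. token_leaves cs e = token_leaves ds (g e))"

text \<open>The clique, the order and the leaf counts have each been described through adjacency, so
  each of them is carried along \<open>\<phi>\<close>.\<close>

lemma split_iso_token_map:
  assumes iso: "split_iso r cs s ds \<phi>"
    and r: "trans r" "antisym r" and s: "trans s" "antisym s"
  shows "token_iso r cs s ds (token_map \<phi>)"
proof -
  let ?V = "set (vertex_list cs)" and ?W = "set (vertex_list ds)" and ?g = "token_map \<phi>"
  have \<phi>: "bij_betw \<phi> ?V ?W"
    "\<And>v w. v \<in> ?V \<Longrightarrow> w \<in> ?V \<Longrightarrow> split_adj r v w \<longleftrightarrow> split_adj s (\<phi> v) (\<phi> w)"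
    using iso by (auto simp: split_iso_def)
  have im: "\<phi> ` ?V = ?W" and inj: "inj_on \<phi> ?V"
    using \<phi>(1) by (auto simp: bij_betw_def)
  have in_W: "\<phi> v \<in> ?W" if "v \<in> ?V" for v using that im by blast
  have clique: "snd (snd (\<phi> v)) = 0 \<longleftrightarrow> snd (snd v) = 0" if "v \<in> ?V" for v
  proof -
    have "(\<exists>a\<in>?V. \<exists>b\<in>?V. a \<noteq> b \<and> split_adj r v a \<and> split_adj r v b \<and> \<not> split_adj r a b) \<longleftrightarrow>
        (\<exists>a\<in>?V. \<exists>b\<in>?V. \<phi> a \<noteq> \<phi> b \<and> split_adj s (\<phi> v) (\<phi> a) \<and> split_adj s (\<phi> v) (\<phi> b) \<and>
          \<not> split_adj s (\<phi> a) (\<phi> b))"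
    proof (intro bex_cong[OF refl])
      fix a b assume ab: "a \<in> ?V" "b \<in> ?V"
      show "(a \<noteq> b \<and> split_adj r v a \<and> split_adj r v b \<and> \<not> split_adj r a b) \<longleftrightarrow> (\<phi> a \<noteq> \<phi> b \<and>
          split_adj s (\<phi> v) (\<phi> a) \<and> split_adj s (\<phi> v) (\<phi> b) \<and> \<not> split_adj s (\<phi> a) (\<phi> b))"
        by (simp only: inj_on_eq_iff[OF inj ab] \<phi>(2)[OF that ab(1)] \<phi>(2)[OF that ab(2)] \<phi>(2)[OF ab])
    qed
    also have "\<dots> \<longleftrightarrow> (\<exists>a\<in>?W. \<exists>b\<in>?W. a \<noteq> b \<and> split_adj s (\<phi> v) a \<and> split_adj s (\<phi> v) b \<and> \<not> split_adj s a b)"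
      unfolding im[symmetric] by simp
    finally show ?thesis
      unfolding clique_vertex_iff[OF that, of r] clique_vertex_iff[OF in_W[OF that], of s] by (rule sym)
  qed
  have V0: "vertex_of e 0 \<in> ?V" if "e \<in> tokens cs" for e
    using that by (simp add: vertex_of_in_iff)
  have g: "\<phi> (vertex_of e 0) = vertex_of (?g e) 0" if "e \<in> tokens cs" for e
    using clique[OF V0[OF that]] by (simp add: vertex_of_def token_map_def prod_eq_iff)
  have g_tok: "?g e \<in> tokens ds" if "e \<in> tokens cs" for e
    using in_W[OF V0[OF that]] g[OF that] by (simp add: vertex_of_in_iff)
  have "inj_on ?g (tokens cs)"
  proof (rule inj_onI)
    fix e e' assume e: "e \<in> tokens cs" "e' \<in> tokens cs" "?g e = ?g e'"
    then have "\<phi> (vertex_of e 0) = \<phi> (vertex_of e' 0)" using g by simp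
    with V0 e inj have "vertex_of e 0 = vertex_of e' 0" by (blast dest: inj_onD)
    then show "e = e'" by simp
  qed
  moreover have im_g: "?g ` tokens cs = tokens ds"
  proof (intro equalityI subsetI)
    fix e assume e: "e \<in> tokens ds"
    then have "vertex_of e 0 \<in> ?W" by (simp add: vertex_of_in_iff)
    with im obtain v where v: "v \<in> ?V" "\<phi> v = vertex_of e 0" by (metis imageE)
    then have "snd (snd v) = 0" using clique[of v] by (simp add: vertex_of_def)
    with v(1) obtain e0 where e0: "v = vertex_of e0 0" "e0 \<in> tokens cs"
      by (auto elim!: vertex_cases)
    with v g[of e0] have "e = ?g e0" by simp
    with e0 show "e \<in> ?g ` tokens cs" by blast
  qed (use g_tok in auto)
  ultimately have bij: "bij_betw ?g (tokens cs) (tokens ds)" by (simp add: bij_betw_def)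
  have le: "token_le r e e' \<longleftrightarrow> token_le s (?g e) (?g e')" if e: "e \<in> tokens cs" "e' \<in> tokens cs" for e e'
  proof -
    have "token_le r e e' \<longleftrightarrow> (\<forall>l\<in>?V. snd (snd (\<phi> l)) \<noteq> 0 \<longrightarrow>
        split_adj s (\<phi> l) (vertex_of (?g e) 0) \<longrightarrow> split_adj s (\<phi> l) (vertex_of (?g e') 0))"
      unfolding token_le_iff_leaves[OF r e] using clique \<phi>(2) V0 g e by simp
    also have "\<dots> \<longleftrightarrow> token_le s (?g e) (?g e')"
      unfolding token_le_iff_leaves[OF s g_tok[OF e(1)] g_tok[OF e(2)]] im[symmetric] by simp
    finally show ?thesis .
  qed
  have "token_leaves cs e = token_leaves ds (?g e)" if e: "e \<in> tokens cs" for e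
  proof -
    let ?S = "{l \<in> ?V. snd (snd l) \<noteq> 0 \<and> (\<forall>e'\<in>tokens cs. split_adj r l (vertex_of e' 0) \<longleftrightarrow> token_le r e e')}"
    have "{l \<in> ?W. snd (snd l) \<noteq> 0 \<and> (\<forall>e'\<in>tokens ds. split_adj s l (vertex_of e' 0) \<longleftrightarrow> token_le s (?g e) e')}
        = \<phi> ` {l \<in> ?V. snd (snd (\<phi> l)) \<noteq> 0 \<and>
            (\<forall>e'\<in>tokens cs. split_adj s (\<phi> l) (vertex_of (?g e') 0) \<longleftrightarrow> token_le s (?g e) (?g e'))}"
      unfolding im[symmetric] im_g[symmetric] Compr_image_eq ball_simps(9) ..
    also have "{l \<in> ?V. snd (snd (\<phi> l)) \<noteq> 0 \<and>
        (\<forall>e'\<in>tokens cs. split_adj s (\<phi> l) (vertex_of (?g e') 0) \<longleftrightarrow> token_le s (?g e) (?g e'))} = ?S"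
    proof (intro Collect_cong conj_cong refl)
      fix l assume l: "l \<in> ?V"
      show "snd (snd (\<phi> l)) \<noteq> 0 \<longleftrightarrow> snd (snd l) \<noteq> 0" using clique[OF l] by simp
      show "(\<forall>e'\<in>tokens cs. split_adj s (\<phi> l) (vertex_of (?g e') 0) \<longleftrightarrow> token_le s (?g e) (?g e')) \<longleftrightarrow>
          (\<forall>e'\<in>tokens cs. split_adj r l (vertex_of e' 0) \<longleftrightarrow> token_le r e e')"
      proof (rule ball_cong[OF refl])
        fix e' assume e': "e' \<in> tokens cs"
        show "(split_adj s (\<phi> l) (vertex_of (?g e') 0) \<longleftrightarrow> token_le s (?g e) (?g e')) \<longleftrightarrow>
            (split_adj r l (vertex_of e' 0) \<longleftrightarrow> token_le r e e')"
          unfolding \<phi>(2)[OF l V0[OF e']] g[OF e'] le[OF e e'] ..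
      qed
    qed
    finally have "token_leaves ds (?g e) = card (\<phi> ` ?S)"
      using token_leaves_eq_card[OF s(2) g_tok[OF e]] by simp
    also have "\<dots> = card ?S"
      by (rule card_image) (rule inj_on_subset[OF inj], auto)
    finally show ?thesis using token_leaves_eq_card[OF r(2) e] by simp
  qed
  with bij le show ?thesis by (simp add: token_iso_def)
qed

section \<open>Elements and colors recovered from the tokens\<close>

lemma bij_betw_atMost_mono_eq:
  fixes h :: "nat \<Rightarrow> nat"
  assumes "bij_betw h {..a} {..b}" "\<And>i j. i \<le> a \<Longrightarrow> j \<le> a \<Longrightarrow> i \<le> j \<longleftrightarrow> h i \<le> h j"
  shows "a = b" "\<And>i. i \<le> a \<Longrightarrow> h i = i"
proof -
  show "a = b" using bij_betw_same_card[OF assms(1)] by simp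
  fix i assume i: "i \<le> a"
  \<comment> \<open>An order isomorphism maps initial segments onto initial segments; comparing
    their sizes yields \<open>h i = i\<close>.\<close>
  have "h ` {..i} = {..h i}"
  proof (intro equalityI subsetI)
    fix y assume y: "y \<in> {..h i}"
    have "h i \<le> b" using bij_betw_apply[OF assms(1), of i] i by simp
    with y bij_betw_imp_surj_on[OF assms(1)] obtain x where "x \<le> a" "y = h x"
      by (metis atMost_iff imageE order_trans)
    with y assms(2) i show "y \<in> h ` {..i}" by auto
  next
    fix y assume "y \<in> h ` {..i}"
    then obtain x where "x \<le> i" "y = h x" by auto
    with assms(2)[of x i] i show "y \<in> {..h i}" by simp
  qed
  moreover have "inj_on h {..i}"
    using bij_betw_imp_inj_on[OF assms(1)] i by (auto intro: inj_on_subset)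
  ultimately have "card {..h i} = card {..i}" by (metis card_image)
  then show "h i = i" by simp
qed

lemma token_leaves_eq_4_iff: "e \<in> tokens cs \<Longrightarrow> token_leaves cs e = 4 \<longleftrightarrow> snd e = length (cs ! fst e)"
  by (auto simp: token_leaves_def leaves_def tokens_def)

text \<open>End tokens are exactly the tokens with four leaves, so \<open>g\<close> permutes them
  and thereby induces the map \<open>f\<close> on elements. The other tokens follow their end
  tokens, which transports the colors.\<close>

lemma token_iso_imp_colored_poset_iso:
  assumes r: "partial_order_on {..<length cs} r" and s: "partial_order_on {..<length ds} s"
    and iso: "token_iso r cs s ds g"
  shows "\<exists>f. is_poset_iso {..<length cs} r {..<length ds} s f \<and> (\<forall>a<length cs. ds ! f a = cs ! a)"
proof -
  have bij: "bij_betw g (tokens cs) (tokens ds)"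
    and le: "\<And>e e'. e \<in> tokens cs \<Longrightarrow> e' \<in> tokens cs \<Longrightarrow> token_le r e e' \<longleftrightarrow> token_le s (g e) (g e')"
    and lv: "\<And>e. e \<in> tokens cs \<Longrightarrow> token_leaves cs e = token_leaves ds (g e)"
    using iso by (auto simp: token_iso_def)
  note rD = partial_order_onD[OF r] and sD = partial_order_onD[OF s]
  have inj: "inj_on g (tokens cs)" and im: "g ` tokens cs = tokens ds"
    using bij by (auto simp: bij_betw_def)
  define end_cs where "end_cs i = (i, length (cs ! i))" for i
  define end_ds where "end_ds i = (i, length (ds ! i))" for i
  define f where "f i = fst (g (end_cs i))" for i
  have end_cs: "end_cs i \<in> tokens cs" if "i < length cs" for i
    using that by (simp add: end_cs_def tokens_def)
  have end_ds: "end_ds i \<in> tokens ds" if "i < length ds" for i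
    using that by (simp add: end_ds_def tokens_def)
  have g_tok: "g e \<in> tokens ds" if "e \<in> tokens cs" for e using that im by blast
  have g_end: "g (end_cs i) = end_ds (f i)" if "i < length cs" for i
  proof -
    have "token_leaves ds (g (end_cs i)) = 4"
      using lv[OF end_cs[OF that]] by (simp add: end_cs_def token_leaves_def leaves_def)
    with token_leaves_eq_4_iff[OF g_tok[OF end_cs[OF that]]] show ?thesis
      by (simp add: end_ds_def f_def prod_eq_iff)
  qed
  have f_less: "f i < length ds" if "i < length cs" for i
    using g_tok[OF end_cs[OF that]] g_end[OF that] by (auto simp: tokens_def end_ds_def)
  have surj: "\<exists>i<length cs. f i = i'" if "i' < length ds" for i'
  proof -
    from end_ds[OF that] im obtain e where e: "e \<in> tokens cs" "g e = end_ds i'" by (metis imageE)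
    have "token_leaves cs e = 4"
      using lv[OF e(1)] by (simp add: e(2) end_ds_def token_leaves_def leaves_def)
    with token_leaves_eq_4_iff[OF e(1)] e(1) have "e = end_cs (fst e)" "fst e < length cs"
      by (auto simp: end_cs_def tokens_def prod_eq_iff)
    with g_end e(2) show ?thesis by (metis end_ds_def fst_conv)
  qed
  have order: "(i, i') \<in> r \<longleftrightarrow> (f i, f i') \<in> s" if i: "i < length cs" "i' < length cs" for i i'
  proof (cases "i = i'")
    case True
    with rD(1) sD(1) i f_less show ?thesis by (simp add: refl_on_def)
  next
    case False
    have "f i \<noteq> f i'"
    proof
      assume "f i = f i'"
      then have "g (end_cs i) = g (end_cs i')" using g_end i by simp
      then have "end_cs i = end_cs i'" using inj end_cs i by (blast dest: inj_onD)
      with False show False by (simp add: end_cs_def)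
    qed
    with False le[OF end_cs[OF i(1)] end_cs[OF i(2)]] g_end i show ?thesis
      by (simp add: end_cs_def end_ds_def)
  qed
  have inj_f: "inj_on f {..<length cs}"
  proof (rule inj_onI)
    fix i i' assume i: "i \<in> {..<length cs}" "i' \<in> {..<length cs}" "f i = f i'"
    then have "(i, i') \<in> r" "(i', i) \<in> r"
      using order[of i i'] order[of i' i] sD(1) f_less by (simp_all add: refl_on_def)
    with rD(3) show "i = i'" by (blast dest: antisymD)
  qed
  have f_bij: "bij_betw f {..<length cs} {..<length ds}"
    using inj_f f_less surj unfolding bij_betw_def by blast
  \<comment> \<open>Let \<open>g e\<close> lie in the block of \<open>f i3\<close>. An end token
    lies above its whole block. Used on the target side this puts \<open>fst e\<close> below
    \<open>i3\<close>, used on the source side it puts \<open>i3\<close> below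
    \<open>fst e\<close>.\<close>
  have block: "fst (g e) = f (fst e)" if e: "e \<in> tokens cs" for e
  proof -
    let ?i = "fst e"
    have i: "?i < length cs" using e by (auto simp: tokens_def)
    have "fst (g e) < length ds" using g_tok[OF e] by (auto simp: tokens_def)
    then obtain i3 where i3: "i3 < length cs" "f i3 = fst (g e)" using surj by blast
    have "token_le s (g e) (end_ds (f i3))"
      using g_tok[OF e] i3(2) by (cases "g e") (auto simp: end_ds_def tokens_def)
    with g_end[OF i3(1)] le[OF e end_cs[OF i3(1)]] have "token_le r e (end_cs i3)" by simp
    then have 1: "?i = i3 \<or> (?i, i3) \<in> r" by (cases e) (auto simp: end_cs_def)
    have "token_le r e (end_cs ?i)"
      using e by (cases e) (auto simp: end_cs_def tokens_def)
    with g_end[OF i] le[OF e end_cs[OF i]] have "token_le s (g e) (end_ds (f ?i))" by simp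
    then have "f i3 = f ?i \<or> (f i3, f ?i) \<in> s"
      using i3(2) by (cases "g e") (auto simp: end_ds_def)
    then have 2: "?i = i3 \<or> (i3, ?i) \<in> r"
      using order[OF i3(1) i] inj_f i i3(1) by (auto dest: inj_onD)
    from 1 2 rD(3) have "?i = i3" by (blast dest: antisymD)
    with i3 show ?thesis by simp
  qed
  have color: "ds ! f i = cs ! i" if i: "i < length cs" for i
  proof -
    \<comment> \<open>By \<open>block\<close>, the tokens of \<open>i\<close> correspond to those of
      \<open>f i\<close>. So \<open>h\<close> is an order isomorphism of initial segments, hence the
      identity, and the leaf counts compare the colors bit by bit.\<close>
    define h where "h j = snd (g (i, j))" for j
    let ?a = "length (cs ! i)" and ?b = "length (ds ! f i)"
    have tok: "(i, j) \<in> tokens cs" if "j \<le> ?a" for j using that i by (simp add: tokens_def)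
    have gij: "g (i, j) = (f i, h j)" if "j \<le> ?a" for j
      using block[OF tok[OF that]] by (simp add: h_def prod_eq_iff)
    have h_mono: "j \<le> j' \<longleftrightarrow> h j \<le> h j'" if "j \<le> ?a" "j' \<le> ?a" for j j'
      using le[OF tok[OF that(1)] tok[OF that(2)]] gij that by simp
    have "bij_betw h {..?a} {..?b}"
      unfolding bij_betw_def
    proof (intro conjI equalityI subsetI)
      show "inj_on h {..?a}"
        by (rule inj_onI) (metis atMost_iff h_mono order_antisym order_refl)
      fix y assume "y \<in> h ` {..?a}"
      then obtain j where "j \<le> ?a" "y = h j" by auto
      with g_tok[OF tok[OF this(1)]] gij show "y \<in> {..?b}" by (simp add: tokens_def)
    next
      fix y assume "y \<in> {..?b}"
      then have "(f i, y) \<in> tokens ds" using f_less i by (simp add: tokens_def)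
      with im obtain e where e: "e \<in> tokens cs" "g e = (f i, y)" by (metis imageE)
      then have "f (fst e) = f i" using block by fastforce
      moreover have "fst e < length cs" using e(1) by (auto simp: tokens_def)
      ultimately have "fst e = i" using inj_f i by (auto dest: inj_onD)
      with e show "y \<in> h ` {..?a}" by (cases e) (auto simp: h_def tokens_def image_iff intro!: bexI[of _ "snd e"])
    qed
    note h = bij_betw_atMost_mono_eq[OF this h_mono]
    show ?thesis
    proof (rule nth_equalityI)
      show "length (ds ! f i) = length (cs ! i)" using h(1) by simp
      fix j assume "j < length (ds ! f i)"
      then have j: "j < ?a" "j < ?b" using h(1) by simp_all
      have "token_leaves ds (f i, j) = token_leaves cs (i, j)"
        using lv[OF tok[of j]] gij[of j] h(2)[of j] j by simp
      with j show "ds ! f i ! j = cs ! i ! j"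
        by (simp add: token_leaves_def leaves_def split: if_splits)
    qed
  qed
  have "is_poset_iso {..<length cs} r {..<length ds} s f"
    using f_bij order by (auto simp: is_poset_iso_def)
  with color show ?thesis by blast
qed

text \<open>Equal colors give equally long chains with equal leaf counts, so relabelling the element
  alone is already a bijection of the triples.\<close>

lemma colored_poset_iso_imp_split_iso:
  assumes f: "is_poset_iso {..<length cs} r {..<length ds} s f"
    and col: "\<forall>a<length cs. ds ! f a = cs ! a"
  shows "split_iso r cs s ds (\<lambda>(i, j, k). (f i, j, k))" (is "split_iso _ _ _ _ ?\<phi>")
proof -
  let ?V = "set (vertex_list cs)" and ?W = "set (vertex_list ds)"
  have bij: "bij_betw f {..<length cs} {..<length ds}"
    and ord: "\<And>a b. a < length cs \<Longrightarrow> b < length cs \<Longrightarrow> (a, b) \<in> r \<longleftrightarrow> (f a, f b) \<in> s"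
    using f by (auto simp: is_poset_iso_def)
  have inj: "inj_on f {..<length cs}" and im: "f ` {..<length cs} = {..<length ds}"
    using bij by (auto simp: bij_betw_def)
  have eq: "f a = f b \<longleftrightarrow> a = b" if "a < length cs" "b < length cs" for a b
    using inj that by (auto dest: inj_onD)
  have lt: "f a < length ds" if "a < length cs" for a using im that by blast
  have "inj_on ?\<phi> ?V"
    by (auto simp: inj_on_def set_vertex_list eq)
  moreover have "?\<phi> ` ?V = ?W"
  proof (intro equalityI subsetI)
    fix v assume "v \<in> ?\<phi> ` ?V"
    with col lt show "v \<in> ?W" by (auto simp: set_vertex_list)
  next
    fix v assume "v \<in> ?W"
    then obtain i j k where v: "v = (i, j, k)" "i < length ds" "j \<le> length (ds ! i)" "k \<le> leaves (ds ! i) j"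
      by (metis set_vertex_list surj_pair)
    then have "i \<in> f ` {..<length cs}" using im by simp
    then obtain a where "a < length cs" "f a = i" by auto
    with v col show "v \<in> ?\<phi> ` ?V"
      by (intro image_eqI[of _ _ "(a, j, k)"]) (auto simp: set_vertex_list)
  qed
  moreover have "split_adj r v w \<longleftrightarrow> split_adj s (?\<phi> v) (?\<phi> w)" if "v \<in> ?V" "w \<in> ?V" for v w
  proof -
    obtain i j k where v: "v = (i, j, k)" by (cases v)
    obtain i' j' k' where w: "w = (i', j', k')" by (cases w)
    have i: "i < length cs" "i' < length cs" using that by (simp_all add: v w set_vertex_list)
    show ?thesis
      by (simp add: v w ord[OF i] ord[OF i(2) i(1)] eq[OF i] eq[OF i(2) i(1)])
  qed
  ultimately show ?thesis
    unfolding split_iso_def bij_betw_def by blast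
qed

theorem split_graph_iso_iff:
  assumes P: "P \<in> colored_posets_of_width d" and Q: "Q \<in> colored_posets_of_width d"
  shows "colored_poset_isomorphic P Q \<longleftrightarrow> digraph_iso (graph_of (split_graph P)) (graph_of (split_graph Q))"
proof -
  obtain n r cs where P': "P = ((n, r), cs)" by (metis surj_pair)
  obtain m s ds where Q': "Q = ((m, s), ds)" by (metis surj_pair)
  have n: "n = length cs" and m: "m = length ds"
    and r: "partial_order_on {..<length cs} r" and s: "partial_order_on {..<length ds} s"
    using P Q by (auto simp: P' Q' colored_posets_of_width_def posets_of_width_def)
  have "colored_poset_isomorphic P Q \<longleftrightarrow> (\<exists>\<phi>. split_iso r cs s ds \<phi>)"
  proof
    assume "colored_poset_isomorphic P Q"
    then obtain f where "is_poset_iso {..<length cs} r {..<length ds} s f" "\<forall>a<length cs. ds ! f a = cs ! a"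
      by (auto simp: P' Q' n m)
    from colored_poset_iso_imp_split_iso[OF this] show "\<exists>\<phi>. split_iso r cs s ds \<phi>" by blast
  next
    assume "\<exists>\<phi>. split_iso r cs s ds \<phi>"
    then obtain \<phi> where "split_iso r cs s ds \<phi>" by blast
    then have "token_iso r cs s ds (token_map \<phi>)"
      using r s by (intro split_iso_token_map) (auto dest: partial_order_onD)
    from token_iso_imp_colored_poset_iso[OF r s this] show "colored_poset_isomorphic P Q"
      by (simp add: P' Q' n m)
  qed
  then show ?thesis by (simp only: P' Q' digraph_iso_split_graph_iff)
qed

section \<open>Hoare triples with running times\<close>

text \<open>Total correctness: a halting run is part of the claim. A bound on the time, unlike the
  exact time, allows branches of different cost to be joined.\<close>

definition hoare :: "bool list \<Rightarrow> (state \<Rightarrow> bool) \<Rightarrow> com \<Rightarrow> nat \<Rightarrow> (state \<Rightarrow> bool) \<Rightarrow> bool" where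
  "hoare w P c T Q \<longleftrightarrow> (\<forall>s. P s \<longrightarrow> (\<exists>t\<le>T. \<exists>s'. exec w c s t s' \<and> Q s'))"

lemma hoare_conseq:
  assumes "hoare w P' c T' Q'" "\<And>m out. P (m, out) \<Longrightarrow> P' (m, out)" "T' \<le> T" "\<And>m out. Q' (m, out) \<Longrightarrow> Q (m, out)"
  shows "hoare w P c T Q"
  unfolding hoare_def
proof (intro allI impI)
  fix s assume "P s"
  with assms(2) have "P' s" by (cases s) auto
  with assms(1) obtain t s' where "t \<le> T'" "exec w c s t s'" "Q' s'"
    unfolding hoare_def by blast
  moreover have "Q s'" using \<open>Q' s'\<close> assms(4) by (cases s') auto
  ultimately show "\<exists>t\<le>T. \<exists>s'. exec w c s t s' \<and> Q s'"
    using assms(3) order_trans by blast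
qed

lemma hoare_pre:
  assumes "hoare w P' c T' Q" "\<And>m out. P (m, out) \<Longrightarrow> P' (m, out)" "T' \<le> T"
  shows "hoare w P c T Q"
  using assms by (rule hoare_conseq)

lemma hoare_skip: "hoare w Q Skip 1 Q"
  unfolding hoare_def by (blast intro: exec.Skip)

lemma hoare_assign:
  "hoare w (\<lambda>(m, out). Q (m(expr_val w m e1 := expr_val w m e2), out)) (Assign e1 e2) 1 Q"
  unfolding hoare_def
proof (intro allI impI)
  fix s assume "case s of (m, out) \<Rightarrow> Q (m(expr_val w m e1 := expr_val w m e2), out)"
  with exec.Assign show "\<exists>t\<le>1. \<exists>s'. exec w (Assign e1 e2) s t s' \<and> Q s'"
    by (cases s) (simp only: prod.case, blast)
qed

lemma hoare_output:
  "hoare w (\<lambda>(m, out). Q (m, out @ [expr_val w m e \<noteq> 0])) (Output e) 1 Q"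
  unfolding hoare_def
proof (intro allI impI)
  fix s assume "case s of (m, out) \<Rightarrow> Q (m, out @ [expr_val w m e \<noteq> 0])"
  with exec.Output show "\<exists>t\<le>1. \<exists>s'. exec w (Output e) s t s' \<and> Q s'"
    by (cases s) (simp only: prod.case, blast)
qed

lemma hoare_seq:
  assumes "hoare w P c1 T1 Q" "hoare w Q c2 T2 R"
  shows "hoare w P (Seq c1 c2) (T1 + T2) R"
  unfolding hoare_def
proof (intro allI impI)
  fix s1 assume "P s1"
  with assms(1) obtain t1 s2 where 1: "t1 \<le> T1" "exec w c1 s1 t1 s2" "Q s2"
    unfolding hoare_def by blast
  with assms(2) obtain t2 s3 where "t2 \<le> T2" "exec w c2 s2 t2 s3" "R s3"
    unfolding hoare_def by blast
  with 1 show "\<exists>t\<le>T1 + T2. \<exists>s'. exec w (Seq c1 c2) s1 t s' \<and> R s'"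
    by (intro exI[of _ "t1 + t2"] conjI exI[of _ s3] exec.Seq) auto
qed

text \<open>With the second command treated first, the intermediate assertions are computed from the
  postcondition by unification.\<close>

lemmas hoare_seq_backward = hoare_seq[rotated]

lemma hoare_if:
  assumes "hoare w P1 c1 T Q" "hoare w P2 c2 T Q"
  shows "hoare w (\<lambda>(m, out). if expr_val w m e \<noteq> 0 then P1 (m, out) else P2 (m, out)) (IfElse e c1 c2) (1 + T) Q"
  unfolding hoare_def
proof (intro allI impI)
  fix s assume P: "case s of (m, out) \<Rightarrow> if expr_val w m e \<noteq> 0 then P1 (m, out) else P2 (m, out)"
  show "\<exists>t\<le>1 + T. \<exists>s'. exec w (IfElse e c1 c2) s t s' \<and> Q s'"
  proof (cases "expr_val w (fst s) e = 0")
    case True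
    with P have "P2 s" by (cases s) auto
    with assms(2) obtain t s' where t: "t \<le> T" "exec w c2 s t s'" "Q s'"
      unfolding hoare_def by blast
    from exec.IfFalse[OF True t(2)] have "exec w (IfElse e c1 c2) s (1 + t) s'" .
    with t show ?thesis by (intro exI[of _ "1 + t"] conjI exI[of _ s']) auto
  next
    case False
    with P have "P1 s" by (cases s) auto
    with assms(1) obtain t s' where t: "t \<le> T" "exec w c1 s t s'" "Q s'"
      unfolding hoare_def by blast
    from exec.IfTrue[OF False t(2)] have "exec w (IfElse e c1 c2) s (1 + t) s'" .
    with t show ?thesis by (intro exI[of _ "1 + t"] conjI exI[of _ s']) auto
  qed
qed

text \<open>The invariant is indexed by the number of completed iterations, which takes the place of
  a variant: \<open>continue\<close> and \<open>stop\<close> force exactly \<open>K\<close>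
  iterations. Each costs one step for its test, and one final test is added.\<close>

lemma hoare_while:
  assumes body: "\<And>k. k < K \<Longrightarrow> hoare w (I k) c T (I (Suc k))"
    and continue: "\<And>k m out. k < K \<Longrightarrow> I k (m, out) \<Longrightarrow> expr_val w m e \<noteq> 0"
    and stop: "\<And>m out. I K (m, out) \<Longrightarrow> expr_val w m e = 0"
  shows "hoare w (I 0) (While e c) (K * (T + 1) + 1) (I K)"
proof -
  \<comment> \<open>Downward induction from \<open>K\<close>, as the bound counts the iterations
    still to come.\<close>
  have "hoare w (I k) (While e c) ((K - k) * (T + 1) + 1) (I K)" if "k \<le> K" for k
    using that
  proof (induction rule: inc_induct)
    case base
    have "exec w (While e c) s 1 s" if "I K s" for s
      using that stop[of "fst s" "snd s"] by (intro exec.WhileFalse) simp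
    then show ?case unfolding hoare_def by fastforce
  next
    case (step k)
    show ?case
      unfolding hoare_def
    proof (intro allI impI)
      fix s1 assume s1: "I k s1"
      with body[OF step.hyps(2)] obtain t1 s2 where 1: "t1 \<le> T" "exec w c s1 t1 s2" "I (Suc k) s2"
        unfolding hoare_def by blast
      with step.IH obtain t2 s3 where 2: "t2 \<le> (K - Suc k) * (T + 1) + 1" "exec w (While e c) s2 t2 s3" "I K s3"
        unfolding hoare_def by blast
      have "expr_val w (fst s1) e \<noteq> 0" using continue[OF step.hyps(2)] s1 by (cases s1) auto
      from exec.WhileTrue[OF this 1(2) 2(2)] have "exec w (While e c) s1 (1 + t1 + t2) s3" .
      moreover have "K - k = Suc (K - Suc k)"
        using step.hyps(2) by simp
      then have "(K - k) * (T + 1) = (T + 1) + (K - Suc k) * (T + 1)"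
        by (simp only: mult_Suc)
      then have "1 + t1 + t2 \<le> (K - k) * (T + 1) + 1" using 1(1) 2(1) by linarith
      ultimately show "\<exists>t\<le>(K - k) * (T + 1) + 1. \<exists>s'. exec w (While e c) s1 t s' \<and> I K s'"
        using 2(3) by blast
    qed
  qed
  from this[of 0] show ?thesis by simp
qed

section \<open>Reading the encoding\<close>

definition input_bit :: "bool list \<Rightarrow> nat \<Rightarrow> bool" where
  "input_bit w q \<longleftrightarrow> q < length w \<and> w ! q"

lemma expr_val_Input [simp]: "expr_val w m (Input e) = of_bool (input_bit w (expr_val w m e))"
  by (simp add: input_bit_def Let_def)

declare expr_val.simps(3) [simp del]

lemma length_concat_map_const:
  assumes "\<And>x. x \<in> set xs \<Longrightarrow> length (f x) = n"
  shows "length (concat (map f xs)) = length xs * n"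
  using assms by (induction xs) auto

lemma nth_concat_matrix:
  assumes "i < k" "j < n"
  shows "concat (map (\<lambda>i. map (f i) [0..<n]) [0..<k]) ! (i * n + j) = f i j"
  using assms(1)
proof (induction k)
  case (Suc k)
  have len: "length (concat (map (\<lambda>i. map (f i) [0..<n]) [0..<k])) = k * n"
    using length_concat_map_const[of "[0..<k]" "\<lambda>i. map (f i) [0..<n]" n] by simp
  show ?case
  proof (cases "i = k")
    case True
    with len \<open>j < n\<close> show ?thesis by (simp add: nth_append)
  next
    case False
    with Suc.prems have "i < k" by simp
    then have "(i + 1) * n \<le> k * n" by (intro mult_le_mono) auto
    then have "i * n + j < k * n" using \<open>j < n\<close> by simp
    with len Suc.IH[OF \<open>i < k\<close>] show ?thesis by (simp add: nth_append)
  qed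
qed simp

lemma length_encode_rel: "length (encode_rel (n, r)) = n + 1 + n * n"
  using length_concat_map_const[of "[0..<n]" "\<lambda>i. map (\<lambda>j. (i, j) \<in> r) [0..<n]" n] by simp

lemma input_bit_append_left: "q < length xs \<Longrightarrow> input_bit (xs @ ys) q = input_bit xs q"
  by (simp add: input_bit_def nth_append)

lemma input_bit_append_right: "input_bit (xs @ ys) (length xs + q) = input_bit ys q"
  by (simp add: input_bit_def nth_append)

lemma input_bit_encode_rel:
  "q < n \<Longrightarrow> input_bit (encode_rel (n, r)) q"
  "\<not> input_bit (encode_rel (n, r)) n"
  "i < n \<Longrightarrow> j < n \<Longrightarrow> input_bit (encode_rel (n, r)) (n + 1 + i * n + j) \<longleftrightarrow> (i, j) \<in> r"
proof -
  show "q < n \<Longrightarrow> input_bit (encode_rel (n, r)) q" "\<not> input_bit (encode_rel (n, r)) n"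
    by (simp_all add: input_bit_def nth_append)
  assume ij: "i < n" "j < n"
  then have "(i + 1) * n \<le> n * n" by (intro mult_le_mono) auto
  then have "i * n + j < n * n" using ij by simp
  with nth_concat_matrix[OF ij, of "\<lambda>i j. (i, j) \<in> r"]
    length_concat_map_const[of "[0..<n]" "\<lambda>i. map (\<lambda>j. (i, j) \<in> r) [0..<n]" n]
  show "input_bit (encode_rel (n, r)) (n + 1 + i * n + j) \<longleftrightarrow> (i, j) \<in> r"
    by (simp add: input_bit_def nth_append)
qed

lemma encode_color_simps [simp]:
  "encode_color [] = [False]"
  "encode_color (b # c) = True # b # encode_color c"
  by (simp_all add: encode_color_def)

lemma length_encode_color: "length (encode_color c) = 2 * length c + 1"
  by (induction c) auto

text \<open>Continuation marks sit at even offsets and color bits at odd ones;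
  \<open>j = length c\<close> in the first claim is the end mark.\<close>

lemma input_bit_encode_color:
  "j \<le> length c \<Longrightarrow> input_bit (encode_color c @ ys) (2 * j) \<longleftrightarrow> j < length c"
  "j < length c \<Longrightarrow> input_bit (encode_color c @ ys) (2 * j + 1) \<longleftrightarrow> c ! j"
proof (induction c arbitrary: j)
  case (Cons b c)
  {
    case 1
    with Cons(1)[of "j - 1"] show ?case
      by (cases j) (auto simp: input_bit_def)
  next
    case 2
    with Cons(2)[of "j - 1"] show ?case
      by (cases j) (auto simp: input_bit_def)
  }
qed (simp_all add: input_bit_def)

definition color_pos :: "bool list list \<Rightarrow> nat \<Rightarrow> nat" where
  "color_pos cs i = length cs + 1 + length cs * length cs + length (concat (map encode_color (take i cs)))"

lemma color_pos_Suc: "i < length cs \<Longrightarrow> color_pos cs (Suc i) = color_pos cs i + 2 * length (cs ! i) + 1"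
  by (simp add: color_pos_def take_Suc_conv_app_nth length_encode_color)

lemma input_bit_color_pos:
  assumes "i < length cs"
  shows "j \<le> length (cs ! i) \<Longrightarrow>
      input_bit (encode_colored ((length cs, r), cs)) (color_pos cs i + 2 * j) \<longleftrightarrow> j < length (cs ! i)"
    and "j < length (cs ! i) \<Longrightarrow>
      input_bit (encode_colored ((length cs, r), cs)) (color_pos cs i + 2 * j + 1) \<longleftrightarrow> cs ! i ! j"
proof -
  let ?xs = "encode_rel (length cs, r) @ concat (map encode_color (take i cs))"
  let ?ys = "concat (map encode_color (drop (Suc i) cs))"
  have "concat (map encode_color cs) =
      concat (map encode_color (take i cs)) @ encode_color (cs ! i) @ ?ys"
    using arg_cong[OF id_take_nth_drop[OF assms], of "\<lambda>cs. concat (map encode_color cs)"] by simp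
  then have eq: "encode_colored ((length cs, r), cs) = ?xs @ encode_color (cs ! i) @ ?ys"
    by (simp del: encode_rel.simps)
  have len: "length ?xs = color_pos cs i"
    unfolding color_pos_def length_append length_encode_rel ..
  have *: "input_bit (encode_colored ((length cs, r), cs)) (color_pos cs i + q) =
      input_bit (encode_color (cs ! i) @ ?ys) q" for q
    unfolding eq len[symmetric] by (rule input_bit_append_right)
  show "j \<le> length (cs ! i) \<Longrightarrow>
      input_bit (encode_colored ((length cs, r), cs)) (color_pos cs i + 2 * j) \<longleftrightarrow> j < length (cs ! i)"
    unfolding * by (rule input_bit_encode_color)
  show "j < length (cs ! i) \<Longrightarrow>
      input_bit (encode_colored ((length cs, r), cs)) (color_pos cs i + 2 * j + 1) \<longleftrightarrow> cs ! i ! j"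
    unfolding add.assoc * by (rule input_bit_encode_color)
qed

lemma input_bit_encode_colored:
  "q < n \<Longrightarrow> input_bit (encode_colored ((n, r), cs)) q"
  "\<not> input_bit (encode_colored ((n, r), cs)) n"
  "i < n \<Longrightarrow> j < n \<Longrightarrow> input_bit (encode_colored ((n, r), cs)) (n + 1 + i * n + j) \<longleftrightarrow> (i, j) \<in> r"
proof -
  have *: "input_bit (encode_colored ((n, r), cs)) q = input_bit (encode_rel (n, r)) q" if "q < n + 1 + n * n" for q
    using that unfolding encode_colored.simps
    by (intro input_bit_append_left) (simp only: length_encode_rel)
  show "q < n \<Longrightarrow> input_bit (encode_colored ((n, r), cs)) q" "\<not> input_bit (encode_colored ((n, r), cs)) n"
    using *[of q] *[of n] input_bit_encode_rel(1,2) by simp_all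
  assume ij: "i < n" "j < n"
  then have "(i + 1) * n \<le> n * n" by (intro mult_le_mono) auto
  then have "n + 1 + i * n + j < n + 1 + n * n" using ij by simp
  with * input_bit_encode_rel(3)[OF ij] show "input_bit (encode_colored ((n, r), cs)) (n + 1 + i * n + j) \<longleftrightarrow> (i, j) \<in> r"
    by blast
qed

section \<open>The program\<close>

text \<open>
  Cell 0 holds \<open>n\<close>, cell 1 the reading position, cell 2 the position of the row of the current
  element \<open>i\<close> in the input matrix, cells 3 and 4 hold the current \<open>i\<close> and \<open>j\<close>, and cell 5 is the
  number of vertices found so far. The vertex number \<open>q\<close> is stored in the cells \<open>10 + 4 * q\<close> to
  \<open>13 + 4 * q\<close>, the second of which is the row position of its element: multiplication is not available.
\<close>

abbreviation cell :: "nat \<Rightarrow> expr" where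
  "cell a \<equiv> Cell (Const a)"

abbreviation incr :: "nat \<Rightarrow> com" where
  "incr a \<equiv> Assign (Const a) (Plus (cell a) (Const 1))"

definition field :: "nat \<Rightarrow> nat \<Rightarrow> expr" where
  "field t a = Plus (Const (10 + t)) (Plus (Plus (cell a) (cell a)) (Plus (cell a) (cell a)))"

lemma expr_val_field [simp]: "expr_val w m (field t a) = 10 + t + 4 * m a"
  by (simp add: field_def)

definition push :: "nat \<Rightarrow> com" where
  "push k = Seq (Assign (field 0 5) (cell 3)) (Seq (Assign (field 1 5) (cell 2))
    (Seq (Assign (field 2 5) (cell 4)) (Seq (Assign (field 3 5) (Const k)) (incr 5))))"

fun pushes :: "nat \<Rightarrow> com" where
  "pushes 0 = Skip"
| "pushes (Suc k) = Seq (pushes k) (push k)"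

definition read_size :: com where
  "read_size = While (Input (cell 0)) (incr 0)"

text \<open>The matrix length \<open>n * n\<close> is skipped by adding \<open>n\<close> repeatedly,
  with cell 3 as counter. Before that, cell 2 receives the start of the matrix, which is the row
  position of the element 0.\<close>

definition find_colors :: com where
  "find_colors = Seq (Assign (Const 1) (Plus (cell 0) (Const 1))) (Seq (Assign (Const 2) (cell 1))
    (Seq (While (Minus (cell 0) (cell 3)) (Seq (Assign (Const 1) (Plus (cell 1) (cell 0))) (incr 3)))
      (Assign (Const 3) (Const 0))))"

text \<open>Both bits need the clique vertex and two leaves; only the bit True gets a third leaf.
  The two increments of cell 1 step over the continuation mark and over the bit.\<close>

definition read_token :: com where
  "read_token = Seq (pushes 3) (Seq (incr 1) (Seq (IfElse (Input (cell 1)) (push 3) Skip) (Seq (incr 1) (incr 4))))"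

definition read_color :: com where
  "read_color = Seq (While (Input (cell 1)) read_token) (Seq (pushes 5) (Seq (incr 1)
    (Seq (Assign (Const 4) (Const 0)) (Seq (Assign (Const 2) (Plus (cell 2) (cell 0))) (incr 3)))))"

definition read_colors :: com where
  "read_colors = While (Minus (cell 0) (cell 3)) read_color"

definition write_size :: com where
  "write_size = Seq (While (Minus (cell 5) (cell 6)) (Seq (Output (Const 1)) (incr 6))) (Output (Const 0))"

definition not_expr :: "expr \<Rightarrow> expr" where
  "not_expr e = Minus (Const 1) e"

text \<open>A conjunction only for operands with value 0 or 1, whereas \<open>not_expr\<close>
  accepts any number.\<close>

definition and_expr :: "expr \<Rightarrow> expr \<Rightarrow> expr" where
  "and_expr e e' = Minus (Plus e e') (Const 1)"

definition eq_expr :: "expr \<Rightarrow> expr \<Rightarrow> expr" where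
  "eq_expr e e' = Minus (Const 1) (Plus (Minus e e') (Minus e' e))"

text \<open>\<open>Plus\<close> acts as disjunction. The summands exclude each other through
  \<open>same\<close>, so the value stays 0 or 1, as \<open>and_expr\<close> requires. The stored
  row position of one element plus the number of the other addresses their matrix entry.\<close>

definition token_le_expr :: "nat \<Rightarrow> nat \<Rightarrow> expr" where
  "token_le_expr a b = (let same = eq_expr (Cell (field 0 a)) (Cell (field 0 b)) in
    Plus (and_expr same (not_expr (Minus (Cell (field 2 a)) (Cell (field 2 b)))))
      (and_expr (not_expr same) (Input (Plus (Cell (field 1 a)) (Cell (field 0 b))))))"

definition split_adj_expr :: expr where
  "split_adj_expr =
    (let clique_a = not_expr (Cell (field 3 7)); clique_b = not_expr (Cell (field 3 8)) in
      Plus (and_expr (and_expr clique_a clique_b) (not_expr (and_expr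
          (eq_expr (Cell (field 0 7)) (Cell (field 0 8))) (eq_expr (Cell (field 2 7)) (Cell (field 2 8))))))
        (Plus (and_expr (and_expr clique_a (not_expr clique_b)) (token_le_expr 8 7))
          (and_expr (and_expr (not_expr clique_a) clique_b) (token_le_expr 7 8))))"

definition write_row :: com where
  "write_row = While (Minus (cell 5) (cell 8)) (Seq (Output split_adj_expr) (incr 8))"

definition write_matrix :: com where
  "write_matrix = While (Minus (cell 5) (cell 7)) (Seq (Assign (Const 8) (Const 0)) (Seq write_row (incr 7)))"

definition split_graph_program :: com where
  "split_graph_program = Seq read_size (Seq find_colors (Seq read_colors (Seq write_size write_matrix)))"

section \<open>Invariants and running times of the program\<close>

definition stored :: "nat \<Rightarrow> (nat \<times> nat \<times> nat) list \<Rightarrow> (nat \<Rightarrow> nat) \<Rightarrow> bool" where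
  "stored n vs m \<longleftrightarrow> m 5 = length vs \<and> (\<forall>q<length vs. m (10 + 4 * q) = fst (vs ! q) \<and>
    m (11 + 4 * q) = n + 1 + fst (vs ! q) * n \<and> m (12 + 4 * q) = fst (snd (vs ! q)) \<and>
    m (13 + 4 * q) = snd (snd (vs ! q)))"

lemma stored_upd [simp]: "a < 10 \<Longrightarrow> a \<noteq> 5 \<Longrightarrow> stored n vs (m(a := x)) = stored n vs m"
  by (simp add: stored_def)

lemma stored_snoc:
  assumes "stored n vs m"
  shows "stored n (vs @ [(i, j, k)]) (m(10 + 4 * length vs := i, 11 + 4 * length vs := n + 1 + i * n,
    12 + 4 * length vs := j, 13 + 4 * length vs := k, 5 := Suc (length vs)))"
  using assms unfolding stored_def
  by (auto simp: nth_append less_Suc_eq)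

text \<open>Cells 6 and 7 are counters of the writing phase, which relies on finding them still
  0.\<close>

definition reading :: "nat \<Rightarrow> nat \<Rightarrow> nat \<Rightarrow> nat \<Rightarrow> (nat \<times> nat \<times> nat) list \<Rightarrow> state \<Rightarrow> bool" where
  "reading n p i j vs = (\<lambda>(m, out). out = [] \<and> m 0 = n \<and> m 1 = p \<and> m 2 = n + 1 + i * n \<and>
    m 3 = i \<and> m 4 = j \<and> m 6 = 0 \<and> m 7 = 0 \<and> stored n vs m)"

lemma reading_push:
  assumes "reading n p i j vs (m, out)"
  shows "reading n p i j (vs @ [(i, j, k)]) (m(10 + 4 * m 5 := m 3, 11 + 4 * m 5 := m 2,
    12 + 4 * m 5 := m 4, 13 + 4 * m 5 := k, 5 := Suc (m 5)), out)"
proof -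
  have "m 5 = length vs" using assms by (simp add: reading_def stored_def)
  with assms stored_snoc[of n vs m i j k] show ?thesis by (simp add: reading_def)
qed

lemma hoare_push: "hoare w (reading n p i j vs) (push k) 5 (reading n p i j (vs @ [(i, j, k)]))"
  unfolding push_def
  by (rule hoare_pre, (rule hoare_seq_backward hoare_assign)+) (simp_all add: reading_push)

lemma hoare_pushes:
  "hoare w (reading n p i j vs) (pushes K) (5 * K + 1) (reading n p i j (vs @ map (\<lambda>k. (i, j, k)) [0..<K]))"
proof (induction K)
  case 0
  show ?case using hoare_skip[of w "reading n p i j vs"] by simp
next
  case (Suc K)
  show ?case
    using hoare_seq[OF Suc.IH hoare_push[of w n p i j _ K]] by (auto elim: hoare_conseq)
qed


text \<open>The program never consults \<open>Input_Length\<close>, so only the bits matter.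
  Comparing bit functions instead of words admits a shorter \<open>w\<close> whose missing bits are
  all read as False.\<close>

definition matches :: "bool list \<Rightarrow> nat rel \<Rightarrow> bool list list \<Rightarrow> bool" where
  "matches w r cs \<longleftrightarrow> input_bit w = input_bit (encode_colored ((length cs, r), cs))"

lemma hoare_read_size:
  assumes "matches w r cs"
  shows "hoare w (\<lambda>s. s = (\<lambda>_. 0, [])) read_size (2 * length cs + 1) (\<lambda>s. s = ((\<lambda>_. 0)(0 := length cs), []))"
proof -
  let ?I = "\<lambda>k s. s = ((\<lambda>_. 0)(0 := k), [])"
  have "hoare w (?I 0) read_size (length cs * (1 + 1) + 1) (?I (length cs))"
    unfolding read_size_def
  proof (rule hoare_while)
    show "hoare w (?I k) (incr 0) 1 (?I (Suc k))" for k
      by (rule hoare_pre, rule hoare_assign) auto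
  qed (use assms input_bit_encode_colored in \<open>auto simp: matches_def\<close>)
  then show ?thesis by (rule hoare_pre) auto
qed

lemma hoare_find_colors:
  "hoare w (\<lambda>s. s = ((\<lambda>_. 0)(0 := length cs), [])) find_colors (3 * length cs + 4)
    (reading (length cs) (color_pos cs 0) 0 0 [])"
proof -
  let ?n = "length cs"
  let ?I = "\<lambda>k (m, out). out = [] \<and> m = (\<lambda>_. 0)(0 := ?n, 1 := ?n + 1 + k * ?n, 2 := ?n + 1, 3 := k)"
  have loop: "hoare w (?I 0) (While (Minus (cell 0) (cell 3))
      (Seq (Assign (Const 1) (Plus (cell 1) (cell 0))) (incr 3))) (?n * (2 + 1) + 1) (?I ?n)"
  proof (rule hoare_while)
    show "hoare w (?I k) (Seq (Assign (Const 1) (Plus (cell 1) (cell 0))) (incr 3)) 2 (?I (Suc k))" for k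
      by (rule hoare_pre, (rule hoare_seq_backward hoare_assign)+) (auto simp: fun_eq_iff)
  qed auto
  have last: "hoare w (?I ?n) (Assign (Const 3) (Const 0)) 1 (reading ?n (color_pos cs 0) 0 0 [])"
    by (rule hoare_pre, rule hoare_assign) (auto simp: reading_def stored_def color_pos_def)
  show ?thesis
    unfolding find_colors_def
    by (rule hoare_pre, rule hoare_seq_backward, rule hoare_seq_backward,
        rule hoare_seq_backward, rule last, rule loop, (rule hoare_assign)+)
      (auto simp: fun_eq_iff)
qed

lemma hoare_incr_position:
  "hoare w (reading n p i j vs) (incr 1) 1 (reading n (p + 1) i j vs)"
  by (rule hoare_pre, rule hoare_assign) (auto simp: reading_def)

lemma hoare_push_one_leaf:
  "hoare w (reading n p i j vs) (IfElse (Input (cell 1)) (push 3) Skip) 6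
    (reading n p i j (vs @ (if input_bit w p then [(i, j, 3)] else [])))" (is "hoare w ?P _ _ ?Q")
proof -
  have "hoare w (\<lambda>s. input_bit w p \<and> ?P s) (push 3) 5 ?Q"
  proof (cases "input_bit w p")
    case True
    show ?thesis by (rule hoare_conseq[OF hoare_push]) (use True in auto)
  next
    case False
    then show ?thesis by (simp add: hoare_def)
  qed
  moreover have "hoare w (\<lambda>s. \<not> input_bit w p \<and> ?P s) Skip 5 ?Q"
    by (rule hoare_pre[OF hoare_skip]) auto
  ultimately show ?thesis
    by (rule hoare_pre[OF hoare_if]) (auto simp: reading_def)
qed

text \<open>The bound is 16 for the three pushes, 6 for the conditional push and 3 for the
  increments.\<close>

lemma hoare_read_token:
  assumes "j < length c" "input_bit w (p + 1) \<longleftrightarrow> c ! j"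
  shows "hoare w (reading n p i j vs) read_token 25 (reading n (p + 2) i (Suc j) (vs @ token_vertices i c j))"
proof -
  let ?vs = "vs @ map (\<lambda>k. (i, j, k)) [0..<3]"
  have vs: "?vs @ (if input_bit w (p + 1) then [(i, j, 3)] else []) = vs @ token_vertices i c j"
    using assms by (simp add: token_vertices_def leaves_def eval_nat_numeral)
  have last: "hoare w (reading n (p + 1) i j (vs @ token_vertices i c j)) (Seq (incr 1) (incr 4)) 2
      (reading n (p + 2) i (Suc j) (vs @ token_vertices i c j))"
    by (rule hoare_pre, (rule hoare_seq_backward hoare_assign)+) (auto simp: reading_def)
  show ?thesis
    unfolding read_token_def
    by (rule hoare_pre[OF hoare_seq[OF hoare_pushes hoare_seq[OF hoare_incr_position
          hoare_seq[OF hoare_push_one_leaf[of w n "p + 1" i j ?vs, unfolded vs] last]]]]) auto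
qed

definition element_vertices :: "nat \<Rightarrow> bool list \<Rightarrow> (nat \<times> nat \<times> nat) list" where
  "element_vertices i c = concat (map (token_vertices i c) [0..<Suc (length c)])"

lemma hoare_read_color:
  assumes w: "matches w r cs" and i: "i < length cs"
  shows "hoare w (reading n (color_pos cs i) i 0 vs) read_color (26 * length (cs ! i) + 31)
    (reading n (color_pos cs (Suc i)) (Suc i) 0 (vs @ element_vertices i (cs ! i)))"
proof -
  let ?c = "cs ! i" and ?p = "color_pos cs i"
  let ?L = "length ?c"
  let ?I = "\<lambda>j. reading n (?p + 2 * j) i j (vs @ concat (map (token_vertices i ?c) [0..<j]))"
  have bit: "input_bit w (?p + 2 * j) \<longleftrightarrow> j < ?L" if "j \<le> ?L" for j
    using w input_bit_color_pos(1)[OF i that] by (simp add: matches_def)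
  have loop: "hoare w (?I 0) (While (Input (cell 1)) read_token) (?L * (25 + 1) + 1) (?I ?L)"
  proof (rule hoare_while)
    fix j assume j: "j < ?L"
    have "input_bit w (?p + 2 * j + 1) \<longleftrightarrow> ?c ! j"
      using w input_bit_color_pos(2)[OF i j] by (simp add: matches_def)
    from hoare_read_token[OF j this] show "hoare w (?I j) read_token 25 (?I (Suc j))"
      by (rule hoare_conseq) auto
  next
    fix j m out assume "j < ?L" "?I j (m, out)"
    with bit[of j] show "expr_val w m (Input (cell 1)) \<noteq> 0" by (simp add: reading_def)
  next
    fix m out assume "?I ?L (m, out)"
    with bit[of ?L] show "expr_val w m (Input (cell 1)) = 0" by (simp add: reading_def)
  qed
  let ?vs = "vs @ element_vertices i ?c"
  \<comment> \<open>The five pushes supply the clique vertex and the four leaves of the end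
    token.\<close>
  have vs: "(vs @ concat (map (token_vertices i ?c) [0..<?L])) @ map (\<lambda>k. (i, ?L, k)) [0..<5] = ?vs"
    by (simp add: element_vertices_def token_vertices_def leaves_def eval_nat_numeral)
  have last: "hoare w (reading n (?p + 2 * ?L + 1) i ?L ?vs)
      (Seq (Assign (Const 4) (Const 0)) (Seq (Assign (Const 2) (Plus (cell 2) (cell 0))) (incr 3))) 3
      (reading n (color_pos cs (Suc i)) (Suc i) 0 ?vs)"
    by (rule hoare_pre, (rule hoare_seq_backward hoare_assign)+)
      (auto simp: reading_def color_pos_Suc[OF i])
  show ?thesis
    unfolding read_color_def
    by (rule hoare_pre[OF hoare_seq[OF loop hoare_seq[OF hoare_pushes[of w n "?p + 2 * ?L" i ?L
          "vs @ concat (map (token_vertices i ?c) [0..<?L])" 5, unfolded vs]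
            hoare_seq[OF hoare_incr_position last]]]]) auto
qed

lemma hoare_read_colors:
  assumes w: "matches w r cs" and B: "\<And>i. i < length cs \<Longrightarrow> length (cs ! i) \<le> B"
  shows "hoare w (reading (length cs) (color_pos cs 0) 0 0 []) read_colors (length cs * (26 * B + 32) + 1)
    (\<lambda>(m, out). out = [] \<and> m 6 = 0 \<and> m 7 = 0 \<and> stored (length cs) (vertex_list cs) m)"
proof -
  let ?n = "length cs"
  let ?I = "\<lambda>i. reading ?n (color_pos cs i) i 0 (concat (map (\<lambda>i. element_vertices i (cs ! i)) [0..<i]))"
  have "hoare w (?I 0) read_colors (?n * ((26 * B + 31) + 1) + 1) (?I ?n)"
    unfolding read_colors_def
  proof (rule hoare_while)
    fix i assume i: "i < ?n"
    from hoare_read_color[OF w i] show "hoare w (?I i) read_color (26 * B + 31) (?I (Suc i))"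
      by (rule hoare_conseq) (use B[OF i] in auto)
  qed (auto simp: reading_def)
  then show ?thesis
    by (rule hoare_conseq) (auto simp: reading_def vertex_list_def element_vertices_def)
qed

lemma hoare_write_size:
  "hoare w (\<lambda>(m, out). out = [] \<and> m 6 = 0 \<and> m 7 = 0 \<and> stored n vs m) write_size (3 * length vs + 2)
    (\<lambda>(m, out). out = replicate (length vs) True @ [False] \<and> m 7 = 0 \<and> stored n vs m)"
proof -
  let ?I = "\<lambda>k (m, out). out = replicate k True \<and> m 6 = k \<and> m 7 = 0 \<and> stored n vs m"
  have "hoare w (?I 0) (While (Minus (cell 5) (cell 6)) (Seq (Output (Const 1)) (incr 6)))
      (length vs * (2 + 1) + 1) (?I (length vs))"
  proof (rule hoare_while)
    show "hoare w (?I k) (Seq (Output (Const 1)) (incr 6)) 2 (?I (Suc k))" for k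
      by (rule hoare_pre, (rule hoare_seq_backward hoare_assign hoare_output)+)
        (auto simp: replicate_append_same)
  qed (auto simp: stored_def)
  then have loop: "hoare w (\<lambda>(m, out). out = [] \<and> m 6 = 0 \<and> m 7 = 0 \<and> stored n vs m)
      (While (Minus (cell 5) (cell 6)) (Seq (Output (Const 1)) (incr 6))) (3 * length vs + 1) (?I (length vs))"
    by (rule hoare_pre) auto
  have "hoare w (?I (length vs)) (Output (Const 0)) 1
      (\<lambda>(m, out). out = replicate (length vs) True @ [False] \<and> m 7 = 0 \<and> stored n vs m)"
    by (rule hoare_pre[OF hoare_output]) auto
  from hoare_seq[OF loop this] show ?thesis
    unfolding write_size_def by (rule hoare_pre) auto
qed

lemma expr_val_not_expr: "expr_val w m (not_expr e) = of_bool (expr_val w m e = 0)"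
  by (simp add: not_expr_def)

lemma expr_val_and_expr:
  "expr_val w m e = of_bool a \<Longrightarrow> expr_val w m e' = of_bool b \<Longrightarrow> expr_val w m (and_expr e e') = of_bool (a \<and> b)"
  by (simp add: and_expr_def)

lemma expr_val_eq_expr: "expr_val w m (eq_expr e e') = of_bool (expr_val w m e = expr_val w m e')"
  by (auto simp: eq_expr_def)

lemma expr_val_token_le_expr:
  assumes w: "matches w r cs" and vs: "stored (length cs) vs m" "m a < length vs" "m b < length vs"
    and i: "fst (vs ! m a) < length cs" "fst (vs ! m b) < length cs"
  shows "expr_val w m (token_le_expr a b) =
    of_bool (token_le r (fst (vs ! m a), fst (snd (vs ! m a))) (fst (vs ! m b), fst (snd (vs ! m b))))"
proof -
  obtain ia ja ka where va: "vs ! m a = (ia, ja, ka)" by (cases "vs ! m a")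
  obtain ib jb kb where vb: "vs ! m b = (ib, jb, kb)" by (cases "vs ! m b")
  have val: "expr_val w m (Cell (field 0 a)) = ia" "expr_val w m (Cell (field 2 a)) = ja"
    "expr_val w m (Cell (field 0 b)) = ib" "expr_val w m (Cell (field 2 b)) = jb"
    "expr_val w m (Cell (field 1 a)) = length cs + 1 + ia * length cs"
    using vs va vb by (simp_all add: stored_def)
  have "expr_val w m (Input (Plus (Cell (field 1 a)) (Cell (field 0 b)))) = of_bool ((ia, ib) \<in> r)"
    using w i input_bit_encode_colored(3)[of ia "length cs" ib r cs]
    by (simp only: expr_val_Input expr_val.simps(5) val) (simp add: matches_def va vb)
  from expr_val_and_expr[OF expr_val_not_expr this, of "eq_expr (Cell (field 0 a)) (Cell (field 0 b))"]
    expr_val_and_expr[OF expr_val_eq_expr expr_val_not_expr, of w m "Cell (field 0 a)" "Cell (field 0 b)"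
      "Minus (Cell (field 2 a)) (Cell (field 2 b))"]
  show ?thesis
    by (simp only: token_le_expr_def Let_def expr_val.simps(5) expr_val.simps(6) val expr_val_eq_expr)
      (auto simp: va vb)
qed

lemma expr_val_split_adj_expr:
  assumes w: "matches w r cs" and vs: "stored (length cs) vs m" "m 7 < length vs" "m 8 < length vs"
    and i: "fst (vs ! m 7) < length cs" "fst (vs ! m 8) < length cs"
  shows "expr_val w m split_adj_expr \<noteq> 0 \<longleftrightarrow> split_adj r (vs ! m 7) (vs ! m 8)"
proof -
  obtain ia ja ka where va: "vs ! m 7 = (ia, ja, ka)" by (cases "vs ! m 7")
  obtain ib jb kb where vb: "vs ! m 8 = (ib, jb, kb)" by (cases "vs ! m 8")
  have val: "expr_val w m (Cell (field 0 7)) = ia" "expr_val w m (Cell (field 2 7)) = ja"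
    "expr_val w m (Cell (field 0 8)) = ib" "expr_val w m (Cell (field 2 8)) = jb"
    "expr_val w m (Cell (field 3 7)) = ka" "expr_val w m (Cell (field 3 8)) = kb"
    using vs va vb by (simp_all add: stored_def)
  note le = expr_val_token_le_expr[OF w vs i] expr_val_token_le_expr[OF w vs(1,3,2) i(2,1)]
  let ?c7 = "not_expr (Cell (field 3 7))" and ?c8 = "not_expr (Cell (field 3 8))"
  have "expr_val w m (and_expr (and_expr ?c7 ?c8) (not_expr (and_expr
      (eq_expr (Cell (field 0 7)) (Cell (field 0 8))) (eq_expr (Cell (field 2 7)) (Cell (field 2 8)))))) =
      of_bool ((ka = 0 \<and> kb = 0) \<and> \<not> (ia = ib \<and> ja = jb))"
    using expr_val_and_expr[OF expr_val_and_expr[OF expr_val_not_expr expr_val_not_expr] expr_val_not_expr,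
      of w m "Cell (field 3 7)" "Cell (field 3 8)"]
      expr_val_and_expr[OF expr_val_eq_expr expr_val_eq_expr, of w m "Cell (field 0 7)" "Cell (field 0 8)"
        "Cell (field 2 7)" "Cell (field 2 8)"]
    by (simp only: val of_bool_eq_0_iff)
  moreover have "expr_val w m (and_expr (and_expr ?c7 (not_expr ?c8)) (token_le_expr 8 7)) =
      of_bool ((ka = 0 \<and> kb \<noteq> 0) \<and> token_le r (ib, jb) (ia, ja))"
    using expr_val_and_expr[OF expr_val_and_expr[OF expr_val_not_expr expr_val_not_expr] le(2),
      of "Cell (field 3 7)" ?c8]
    by (simp only: val expr_val_not_expr of_bool_eq_0_iff va vb fst_conv snd_conv)
  moreover have "expr_val w m (and_expr (and_expr (not_expr ?c7) ?c8) (token_le_expr 7 8)) =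
      of_bool ((ka \<noteq> 0 \<and> kb = 0) \<and> token_le r (ia, ja) (ib, jb))"
    using expr_val_and_expr[OF expr_val_and_expr[OF expr_val_not_expr expr_val_not_expr] le(1),
      of ?c7 "Cell (field 3 8)"]
    by (simp only: val expr_val_not_expr of_bool_eq_0_iff va vb fst_conv snd_conv)
  ultimately show ?thesis
    by (simp only: split_adj_expr_def Let_def expr_val.simps(5) va vb split_adj.simps)
      (auto simp del: token_le.simps)
qed

lemma hoare_write_row:
  assumes w: "matches w r cs" and a: "a < length vs" and i: "\<And>v. v \<in> set vs \<Longrightarrow> fst v < length cs"
  shows "hoare w (\<lambda>(m, out). out = out0 \<and> m 7 = a \<and> m 8 = 0 \<and> stored (length cs) vs m) write_row
    (3 * length vs + 1) (\<lambda>(m, out). out = out0 @ map (\<lambda>b. split_adj r (vs ! a) (vs ! b)) [0..<length vs] \<and>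
      m 7 = a \<and> stored (length cs) vs m)"
proof -
  let ?I = "\<lambda>b (m, out). out = out0 @ map (\<lambda>b. split_adj r (vs ! a) (vs ! b)) [0..<b] \<and>
    m 7 = a \<and> m 8 = b \<and> stored (length cs) vs m"
  have "hoare w (?I 0) write_row (length vs * (2 + 1) + 1) (?I (length vs))"
    unfolding write_row_def
  proof (rule hoare_while)
    show "hoare w (?I b) (Seq (Output split_adj_expr) (incr 8)) 2 (?I (Suc b))" if b: "b < length vs" for b
      by (rule hoare_pre, (rule hoare_seq_backward hoare_assign hoare_output)+)
        (use expr_val_split_adj_expr[OF w, of vs] a b i in auto)
  qed (auto simp: stored_def)
  then show ?thesis by (rule hoare_conseq) auto
qed

lemma hoare_write_matrix:
  assumes w: "matches w r cs" and i: "\<And>v. v \<in> set vs \<Longrightarrow> fst v < length cs"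
  shows "hoare w (\<lambda>(m, out). out = out0 \<and> m 7 = 0 \<and> stored (length cs) vs m) write_matrix
    (length vs * (3 * length vs + 4) + 1)
    (\<lambda>(m, out). out = out0 @ concat (map (\<lambda>a. map (\<lambda>b. split_adj r (vs ! a) (vs ! b)) [0..<length vs]) [0..<length vs]))"
proof -
  let ?out = "\<lambda>a. out0 @ concat (map (\<lambda>a. map (\<lambda>b. split_adj r (vs ! a) (vs ! b)) [0..<length vs]) [0..<a])"
  let ?I = "\<lambda>a (m, out). out = ?out a \<and> m 7 = a \<and> stored (length cs) vs m"
  have "hoare w (?I 0) write_matrix (length vs * ((3 * length vs + 3) + 1) + 1) (?I (length vs))"
    unfolding write_matrix_def
  proof (rule hoare_while)
    fix a assume a: "a < length vs"
    let ?row = "map (\<lambda>b. split_adj r (vs ! a) (vs ! b)) [0..<length vs]"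
    have first: "hoare w (?I a) (Assign (Const 8) (Const 0)) 1
        (\<lambda>(m, out). out = ?out a \<and> m 7 = a \<and> m 8 = 0 \<and> stored (length cs) vs m)"
      by (rule hoare_pre[OF hoare_assign]) auto
    have last: "hoare w (\<lambda>(m, out). out = ?out a @ ?row \<and> m 7 = a \<and> stored (length cs) vs m) (incr 7) 1
        (?I (Suc a))"
      by (rule hoare_pre[OF hoare_assign]) auto
    show "hoare w (?I a) (Seq (Assign (Const 8) (Const 0)) (Seq write_row (incr 7))) (3 * length vs + 3) (?I (Suc a))"
      by (rule hoare_pre[OF hoare_seq[OF first hoare_seq[OF hoare_write_row[OF w a i] last]]]) auto
  qed (auto simp: stored_def)
  then show ?thesis by (rule hoare_conseq) auto
qed

text \<open>A token has at most five vertices, and a color has no more tokens than its code has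
  bits.\<close>

lemma length_vertex_list: "length (vertex_list cs) \<le> 5 * length (concat (map encode_color cs))"
proof -
  have "length (element_vertices i c) \<le> 5 * length (encode_color c)" for i c
  proof -
    have "length (element_vertices i c) = (\<Sum>j\<leftarrow>[0..<Suc (length c)]. Suc (leaves c j))"
      by (simp add: element_vertices_def length_concat token_vertices_def comp_def del: upt_Suc)
    also have "\<dots> \<le> (\<Sum>j\<leftarrow>[0..<Suc (length c)]. 5)"
      by (rule sum_list_mono) (simp add: leaves_def)
    also have "\<dots> \<le> 5 * length (encode_color c)"
      by (simp add: sum_list_triv length_encode_color del: upt_Suc)
    finally show ?thesis .
  qed
  then have "(\<Sum>i\<leftarrow>[0..<length cs]. length (element_vertices i (cs ! i))) \<le>
      (\<Sum>i\<leftarrow>[0..<length cs]. 5 * length (encode_color (cs ! i)))"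
    by (intro sum_list_mono) simp
  also have "\<dots> = 5 * (\<Sum>c\<leftarrow>map ((!) cs) [0..<length cs]. length (encode_color c))"
    by (simp add: sum_list_const_mult comp_def del: map_nth)
  finally show ?thesis
    by (simp add: vertex_list_def element_vertices_def length_concat comp_def map_nth del: upt_Suc)
qed

text \<open>Time is measured against the colored encoding even if the actual input \<open>w\<close>
  is shorter.\<close>

lemma split_graph_program_correct:
  assumes w: "matches w r cs"
  shows "\<exists>t m. exec w split_graph_program (\<lambda>_. 0, []) t (m, encode_rel (split_graph ((length cs, r), cs))) \<and>
    t \<le> 101 * (length (encode_colored ((length cs, r), cs)) + 1)\<^sup>2"
proof -
  let ?n = "length cs" and ?vs = "vertex_list cs"
  let ?N = "length ?vs" and ?W = "length (encode_colored ((?n, r), cs))"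
  have W: "?W = ?n + 1 + ?n * ?n + length (concat (map encode_color cs))"
    by (simp only: encode_colored.simps length_append length_encode_rel)
  have n: "?n \<le> ?W" and N: "?N \<le> 5 * ?W"
    using W length_vertex_list[of cs] by simp_all
  have B: "length (cs ! i) \<le> ?W" if "i < ?n" for i
  proof -
    have "length (encode_color (cs ! i)) \<le> (\<Sum>c\<leftarrow>cs. length (encode_color c))"
      using that by (intro member_le_sum_list) auto
    also have "\<dots> \<le> ?W" unfolding W by (simp add: length_concat comp_def)
    finally show ?thesis by (simp add: length_encode_color)
  qed
  have vs: "fst v < ?n" if "v \<in> set ?vs" for v
    using that set_vertex_list[of "fst v" "fst (snd v)" "snd (snd v)" cs] by simp
  define adj where "adj a b = split_adj r (?vs ! a) (?vs ! b)" for a b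
  have "concat (map (\<lambda>a. map (adj a) [0..<?N]) [0..<?N]) =
      concat (map (\<lambda>a. map (\<lambda>b. a < ?N \<and> b < ?N \<and> adj a b) [0..<?N]) [0..<?N])"
    by (rule arg_cong[where f = concat]) simp
  then have out: "replicate ?N True @ [False] @ concat (map (\<lambda>a. map (adj a) [0..<?N]) [0..<?N]) =
      encode_rel (split_graph ((?n, r), cs))"
    by (simp add: Let_def adj_def)
  let ?T = "(2 * ?n + 1) + ((3 * ?n + 4) + ((?n * (26 * ?W + 32) + 1) + ((3 * ?N + 2) + (?N * (3 * ?N + 4) + 1))))"
  have "hoare w (\<lambda>s. s = (\<lambda>_. 0, [])) split_graph_program ?T
      (\<lambda>(m, out). out = (replicate ?N True @ [False]) @ concat (map (\<lambda>a. map (adj a) [0..<?N]) [0..<?N]))"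
    unfolding split_graph_program_def adj_def
    by (rule hoare_seq[OF hoare_read_size[OF w] hoare_seq[OF hoare_find_colors
          hoare_seq[OF hoare_read_colors[OF w B] hoare_seq[OF hoare_write_size hoare_write_matrix[OF w vs]]]]])
  then obtain t m where t: "t \<le> ?T"
    "exec w split_graph_program (\<lambda>_. 0, []) t (m, encode_rel (split_graph ((?n, r), cs)))"
    unfolding hoare_def using out by auto
  have "?n * (26 * ?W + 32) \<le> ?W * (26 * ?W + 32)" using n by (rule mult_le_mono1)
  moreover have "?N * (3 * ?N + 4) \<le> (5 * ?W) * (3 * (5 * ?W) + 4)"
    using N by (intro mult_le_mono) auto
  \<comment> \<open>The leading constant is 26 from reading the colors plus 75 from the matrix,
    namely \<open>3 * 5 * 5\<close> with at most \<open>5 * ?W\<close> vertices.\<close>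
  ultimately have "?T \<le> 101 * (?W * ?W) + 72 * ?W + 9"
    using n N by (simp add: algebra_simps)
  also have "\<dots> \<le> 101 * (?W + 1)\<^sup>2"
    by (simp add: power2_eq_square algebra_simps)
  finally show ?thesis using t order_trans by blast
qed

section \<open>The split graph of a poset of width \<open>d\<close> is an \<open>S\<^sub>d\<close>-graph\<close>

text \<open>Counting the tokens above makes ranks drop strictly upwards. So lower tokens get larger
  places and lie nearer to the center, as the neighborhoods, which are down-sets, require.\<close>

definition token_rank :: "nat rel \<Rightarrow> bool list list \<Rightarrow> nat \<times> nat \<Rightarrow> nat" where
  "token_rank r cs e = card {e' \<in> tokens cs. token_le r e e'}"

lemma finite_tokens: "finite (tokens cs)"
proof -
  have "tokens cs = (SIGMA i:{..<length cs}. {..length (cs ! i)})"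
    by (auto simp: tokens_def)
  then show ?thesis by simp
qed

lemma token_rank_strict:
  assumes "trans r" "antisym r" "e \<in> tokens cs" "token_le r e e'" "e \<noteq> e'"
  shows "token_rank r cs e' < token_rank r cs e"
proof -
  have "{e2 \<in> tokens cs. token_le r e' e2} \<subseteq> {e2 \<in> tokens cs. token_le r e e2}"
    using token_le_trans[OF assms(1,2,4)] by blast
  moreover have "e \<notin> {e2 \<in> tokens cs. token_le r e' e2}"
    using token_le_antisym[OF assms(2,4)] assms(5) by blast
  ultimately show ?thesis
    unfolding token_rank_def using assms(3) finite_tokens[of cs]
    by (intro psubset_card_mono) auto
qed

text \<open>Replacing the elements of a chain by chains gives a chain again, so the cover of the
  elements by \<open>d\<close> chains also covers the tokens and no further ray is needed.\<close>

lemma S_graph_split_graph: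
  assumes "P \<in> colored_posets_of_width d"
  shows "S_graph d (graph_of (split_graph P))"
proof -
  obtain n r cs where P: "P = ((n, r), cs)" by (metis surj_pair)
  have n: "n = length cs" and po: "partial_order_on {..<length cs} r"
    and wd: "(length cs, r) \<in> posets_of_width d"
    using assms by (auto simp: P colored_posets_of_width_def posets_of_width_def)
  note r = partial_order_onD(2,3)[OF po]
  obtain ch where ch: "chain_partition r {..<length cs} d ch"
    using chain_partition_of_width[OF wd] by blast
  define vs where "vs = vertex_list cs"
  define tok where "tok a = (fst (vs ! a), fst (snd (vs ! a)))" for a
  define kind where "kind a = snd (snd (vs ! a))" for a
  define rk where "rk = token_rank r cs"
  let ?G = "graph_of (split_graph P)"
  define U where "U = {a. a < length vs \<and> kind a = 0}"
  have V: "verts ?G = {..<length vs}"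
    by (simp add: P vs_def Let_def)
  have v: "vs ! a = vertex_of (tok a) (kind a)" for a
    by (simp add: tok_def kind_def vertex_of_def)
  have adj: "a \<rightarrow>\<^bsub>?G\<^esub> b \<longleftrightarrow> split_adj r (vertex_of (tok a) (kind a)) (vertex_of (tok b) (kind b))"
    if "a < length vs" "b < length vs" for a b
    using that by (simp add: P vs_def Let_def flip: v)
  have in_vs: "tok a \<in> tokens cs \<and> kind a < 5" if "a < length vs" for a
  proof -
    have "vertex_of (tok a) (kind a) \<in> set (vertex_list cs)"
      using that v[of a] by (metis nth_mem vs_def)
    moreover have "token_leaves cs (tok a) \<le> 4" by (simp add: token_leaves_def leaves_def)
    ultimately show ?thesis by (simp add: vertex_of_in_iff)
  qed
  have eqI: "a = b" if "a < length vs" "b < length vs" "tok a = tok b" "kind a = kind b" for a b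
  proof -
    have "vs ! a = vs ! b" using that v[of a] v[of b] by simp
    with that distinct_vertex_list[of cs] show ?thesis by (simp add: vs_def nth_eq_iff_index_eq)
  qed
  have ch_lt: "ch (fst e) < d" if "e \<in> tokens cs" for e
    using ch that by (auto simp: chain_partition_def tokens_def)
  have comparable: "token_le r e e' \<or> token_le r e' e"
    if "e \<in> tokens cs" "e' \<in> tokens cs" "ch (fst e) = ch (fst e')" for e e'
  proof -
    have "fst e \<in> {..<length cs}" "fst e' \<in> {..<length cs}"
      using that by (auto simp: tokens_def)
    with ch that(3) have "(fst e, fst e') \<in> r \<or> (fst e', fst e) \<in> r"
      unfolding chain_partition_def by blast
    then show ?thesis by (cases e; cases e') auto
  qed
  \<comment> \<open>Tokens on one ray are comparable, so there the rank alone decides the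
    order.\<close>
  have le_of_rank: "token_le r e' e"
    if "e \<in> tokens cs" "e' \<in> tokens cs" "ch (fst e) = ch (fst e')" "rk e \<le> rk e'" for e e'
  proof (rule ccontr)
    assume "\<not> token_le r e' e"
    moreover from this have "e \<noteq> e'" by auto
    ultimately have "token_le r e e'" "e \<noteq> e'" using comparable[OF that(1-3)] by blast+
    then have "rk e' < rk e" unfolding rk_def by (rule token_rank_strict[OF r that(1)])
    with that(4) show False by simp
  qed
  show ?thesis
  \<comment> \<open>Kinds are below 5, so the factor 5 gives the leaves of one token separate places
    while the rank still decides between different tokens.\<close>
  proof (rule S_graph_split[where U = U and c = "\<lambda>a. ch (fst (tok a))" and q = "\<lambda>a. 5 * rk (tok a) + kind a"])
    show "graph ?G" by (rule graph_split_graph)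
    show "U \<subseteq> verts ?G" using V by (auto simp: U_def)
    show "a \<rightarrow>\<^bsub>?G\<^esub> b" if "a \<in> U" "b \<in> U" "a \<noteq> b" for a b
      using that adj[of a b] eqI[of a b] by (auto simp: U_def)
    show "\<not> a \<rightarrow>\<^bsub>?G\<^esub> b" if "a \<in> verts ?G - U" "b \<in> verts ?G - U" for a b
      using that adj[of a b] by (simp add: V U_def)
    show "ch (fst (tok a)) < d" if "a \<in> verts ?G" for a
      using that in_vs[of a] ch_lt by (simp add: V)
    show "a = b" if ab: "a \<in> verts ?G - U" "b \<in> verts ?G - U" "ch (fst (tok a)) = ch (fst (tok b))"
      "5 * rk (tok a) + kind a = 5 * rk (tok b) + kind b" for a b
    proof -
      have lt: "a < length vs" "b < length vs" using ab by (simp_all add: V)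
      note * = in_vs[OF lt(1)] in_vs[OF lt(2)]
      with ab(4) have "rk (tok a) = rk (tok b)" by linarith
      with ab(4) have "kind a = kind b" by simp
      from \<open>rk (tok a) = rk (tok b)\<close> le_of_rank[of "tok a" "tok b"] le_of_rank[of "tok b" "tok a"] * ab(3)
      have "tok a = tok b" by (intro token_le_antisym[OF r(2)]) simp_all
      with eqI[OF lt] \<open>kind a = kind b\<close> show ?thesis by blast
    qed
    show "b \<rightarrow>\<^bsub>?G\<^esub> u" if ab: "u \<in> U" "a \<in> verts ?G - U" "b \<in> verts ?G - U" "a \<rightarrow>\<^bsub>?G\<^esub> u"
      "ch (fst (tok a)) = ch (fst (tok b))" "5 * rk (tok a) + kind a \<le> 5 * rk (tok b) + kind b" for u a b
    proof -
      have lt: "a < length vs" "b < length vs" "u < length vs" and kind: "kind a \<noteq> 0" "kind b \<noteq> 0" "kind u = 0"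
        using ab by (simp_all add: V U_def)
      note * = in_vs[OF lt(1)] in_vs[OF lt(2)]
      with ab(6) have "rk (tok a) \<le> rk (tok b)" by linarith
      with le_of_rank * ab(5) have "token_le r (tok b) (tok a)" by blast
      moreover have "token_le r (tok a) (tok u)"
        using ab(4) adj[OF lt(1,3)] kind by simp
      ultimately have "token_le r (tok b) (tok u)" by (rule token_le_trans[OF r])
      with adj[OF lt(2,3)] kind show ?thesis by simp
    qed
  qed
qed

section \<open>The reductions\<close>

lemma colored_polytime:
  "polytime_computable_on (colored_posets_of_width d) encode_colored encode_rel split_graph"
  unfolding polytime_computable_on_def
proof (rule exI, rule exI, rule ballI)
  fix P assume "P \<in> colored_posets_of_width d"
  then obtain r cs where P: "P = ((length cs, r), cs)"
    by (auto simp: colored_posets_of_width_def)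
  have "matches (encode_colored P) r cs" by (simp add: matches_def P)
  from split_graph_program_correct[OF this]
  show "\<exists>t m. exec (encode_colored P) split_graph_program (\<lambda>_. 0, []) t (m, encode_rel (split_graph P)) \<and>
      t \<le> poly (smult 101 ([:1, 1:]\<^sup>2)) (length (encode_colored P))"
    by (simp add: P poly_power add.commute del: encode_colored.simps split_graph.simps)
qed

text \<open>With the empty color everywhere, each element becomes a single end token, so the order
  itself is not expanded.\<close>

definition uncolored :: "nat \<times> nat rel \<Rightarrow> colored_poset" where
  "uncolored P = (P, replicate (fst P) [])"

lemma uncolored_width: "P \<in> posets_of_width d \<Longrightarrow> uncolored P \<in> colored_posets_of_width d"
  by (cases P) (simp add: uncolored_def colored_posets_of_width_def)

lemma uncolored_isomorphic: "colored_poset_isomorphic (uncolored P) (uncolored Q) \<longleftrightarrow> poset_isomorphic P Q"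
proof -
  \<comment> \<open>The image must be in range for \<open>replicate\<close> to return the empty
    color there.\<close>
  have "f a < m" if "is_poset_iso {..<n} r {..<m} s f" "a < n" for f and a n m :: nat and r s
    using that by (auto simp: is_poset_iso_def bij_betw_def)
  then show ?thesis by (cases P; cases Q) (auto simp: uncolored_def)
qed

lemma encode_uncolored: "encode_colored (uncolored P) = encode_rel P @ replicate (fst P) False"
proof -
  have "concat (map encode_color (replicate n [])) = replicate n False" for n
    by (induction n) auto
  then show ?thesis by (simp add: uncolored_def)
qed

text \<open>
  Reading past the end of the input yields \<open>0\<close>, that is, an end mark, so the same program works
  on uncolored input.
\<close>

lemma uncolored_polytime:
  "polytime_computable_on (posets_of_width d) encode_rel encode_rel (\<lambda>P. split_graph (uncolored P))"
  unfolding polytime_computable_on_def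
proof (rule exI, rule exI, rule ballI)
  fix P assume "P \<in> posets_of_width d"
  obtain n r where P: "P = (n, r)" by (cases P)
  let ?cs = "replicate n [] :: bool list list"
  have unc: "uncolored P = ((length ?cs, r), ?cs)" by (simp add: P uncolored_def)
  have "matches (encode_rel P) r ?cs"
    unfolding matches_def unc[symmetric] encode_uncolored
    by (auto simp: fun_eq_iff input_bit_def nth_append simp del: encode_rel.simps)
  from split_graph_program_correct[OF this, folded unc] obtain t m where
    t: "exec (encode_rel P) split_graph_program (\<lambda>_. 0, []) t (m, encode_rel (split_graph (uncolored P)))"
    "t \<le> 101 * (length (encode_colored (uncolored P)) + 1)\<^sup>2"
    by blast
  \<comment> \<open>The \<open>n\<close> end marks absent from the input at most double its length,
    because it already contains \<open>n\<close> in unary.\<close>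
  have "length (encode_colored (uncolored P)) \<le> 2 * length (encode_rel P)"
    using length_encode_rel[of n r] by (simp add: encode_uncolored P del: encode_rel.simps)
  then have "101 * (length (encode_colored (uncolored P)) + 1)\<^sup>2 \<le> 101 * (2 * length (encode_rel P) + 1)\<^sup>2"
    by (intro mult_le_mono power_mono) auto
  also have "\<dots> = poly (smult 101 ([:1, 2:]\<^sup>2)) (length (encode_rel P))"
    by (simp add: poly_power algebra_simps del: encode_rel.simps)
  finally show "\<exists>t m. exec (encode_rel P) split_graph_program (\<lambda>_. 0, []) t
      (m, encode_rel (split_graph (uncolored P))) \<and> t \<le> poly (smult 101 ([:1, 2:]\<^sup>2)) (length (encode_rel P))"
    using t order_trans by blast
qed

theorem theorem2:
  fixes d :: nat
  shows
    "(\<exists>F :: nat \<times> nat rel \<Rightarrow> nat \<times> nat rel.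
        polytime_computable_on (posets_of_width d) encode_rel encode_rel F \<and>
        (\<forall>P\<in>posets_of_width d. S_graph d (graph_of (F P))) \<and>
        (\<forall>P\<in>posets_of_width d. \<forall>Q\<in>posets_of_width d.
            poset_isomorphic P Q \<longleftrightarrow> digraph_iso (graph_of (F P)) (graph_of (F Q))))
     \<and>
     (\<exists>F :: colored_poset \<Rightarrow> nat \<times> nat rel.
        polytime_computable_on (colored_posets_of_width d) encode_colored encode_rel F \<and>
        (\<forall>P\<in>colored_posets_of_width d. S_graph d (graph_of (F P))) \<and>
        (\<forall>P\<in>colored_posets_of_width d. \<forall>Q\<in>colored_posets_of_width d.
            colored_poset_isomorphic P Q \<longleftrightarrow> digraph_iso (graph_of (F P)) (graph_of (F Q))))"
proof (intro conjI exI ballI)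
  show "polytime_computable_on (posets_of_width d) encode_rel encode_rel (\<lambda>P. split_graph (uncolored P))"
    by (rule uncolored_polytime)
  show "polytime_computable_on (colored_posets_of_width d) encode_colored encode_rel split_graph"
    by (rule colored_polytime)
qed (use S_graph_split_graph split_graph_iso_iff uncolored_width uncolored_isomorphic in blast)+

end
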